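(* For every positive integer $n$ there exists a bijection $\Phi : DC(n)\rightarrow DH(n)$ such that $$\omega(\Phi(C)) = q^{\binom{n}{2}-\mathrm{inv}(C)}$$ for all $C\in DC(n)$.
   Context: Dellac configurations. A Dellac configuration of size $n$ is a placement of $2n$ dots in the cells of a grid with $n$ columns (indexed $1,\dots,n$ from left to right) and $2n$ rows (indexed $1,\dots,2n$ from bottom to top) such that each row contains exactly one dot, each column contains exactly two dots, and every dot in column $j$ and row $i$ satisfies $j\le i\le j+n$. $DC(n)$ is the set of these. An inversion of $C$ is a pair of dots with (column,row) coordinates $(j_1,i_1),(j_2,i_2)$, $j_1<j_2$, $i_1>i_2$; $\mathrm{inv}(C)$ is their number. Dyck paths. A Dyck path of length $2n$ is a sequence $\gamma=(p_0,\dots,p_{2n})$ of points of $\mathbb{N}^2$ with $p_0=(0,0)$, $p_{2n}=(2n,0)$, each step $p_i-p_{i-1}$ equal to $(1,1)$ (up step) or $(1,-1)$ (down step). A Dyck path has $n$ down steps; $s^d_i$ denotes the $i$-th down step from the left. For each $j\in[n]$ the point $p_{2j-2}$ has even height. Dellac histories. A Dellac history of length $2n$ is a pair $(\gamma,\xi)$ where $\gamma=(p_0,\dots,p_{2n})$ is a Dyck path of length $2n$ and $\xi=(\xi_1,\dots,\xi_n)$ with $\xi_i=(n_1(i),n_2(i))$ a pair of nonnegative integers, subject to the following: for each $j\in[n]$, let $2k$ be the height of $p_{2j-2}$; (1) if $(p_{2j-2},p_{2j-1})$ is a down step $s^d_i$ and $(p_{2j-1},p_{2j})$ is an up step, then $k\ge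 n_1(i)>n_2(i)\ge 0$, and $s^d_i$ gets weight $\omega_i=q^{2k-n_1(i)-n_2(i)}$; (2) if $(p_{2j-2},p_{2j-1})$ is an up step and $(p_{2j-1},p_{2j})$ is a down step $s^d_i$, then $0\le n_1(i)\le n_2(i)\le k$, and $\omega_i=q^{2k-n_1(i)-n_2(i)}$; (3) if $(p_{2j-2},p_{2j-1})=s^d_i$ and $(p_{2j-1},p_{2j})=s^d_{i+1}$ are both down steps, then $k-1\ge n_1(i)\ge n_2(i)\ge 0$ with $\omega_i=q^{2k-1-n_1(i)-n_2(i)}$, and $0\le n_1(i+1)\le n_2(i+1)\le k-1$ with $\omega_{i+1}=q^{2k-2-n_1(i+1)-n_2(i+1)}$. The weight of the history is $\omega(\gamma,\xi)=\prod_{i=1}^n\omega_i$. $DH(n)$ is the set of Dellac histories of length $2n$. *)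

theory Defs
  imports Complex_Main "HOL-Computational_Algebra.Formal_Laurent_Series"
begin

text \<open>A configuration is its set of dots, each dot being given as (column, row).\<close>

definition DC :: "nat \<Rightarrow> (nat \<times> nat) set set" where
  "DC n = {C. C \<subseteq> {1..n} \<times> {1..2*n} \<and>
      (\<forall>i\<in>{1..2*n}. card {j. (j, i) \<in> C} = 1) \<and>
      (\<forall>j\<in>{1..n}. card {i. (j, i) \<in> C} = 2) \<and>
      (\<forall>(j, i)\<in>C. j \<le> i \<and> i \<le> j + n)}"

definition inv_DC :: "(nat \<times> nat) set \<Rightarrow> nat" where
  "inv_DC C = card {((j1, i1), (j2, i2)).
      (j1, i1) \<in> C \<and> (j2, i2) \<in> C \<and> j1 < j2 \<and> i1 > i2}"

text \<open>A path is the list of its points; step \<open>m\<close> (for \<open>m \<ge> 1\<close>) goes from point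
  \<open>m - 1\<close> to point \<open>m\<close>. The step predicates are written additively so that no truncated
  subtraction occurs.\<close>

definition up_step :: "(nat \<times> nat) list \<Rightarrow> nat \<Rightarrow> bool" where
  "up_step \<gamma> m \<longleftrightarrow>
     fst (\<gamma> ! m) = fst (\<gamma> ! (m - 1)) + 1 \<and> snd (\<gamma> ! m) = snd (\<gamma> ! (m - 1)) + 1"

definition down_step :: "(nat \<times> nat) list \<Rightarrow> nat \<Rightarrow> bool" where
  "down_step \<gamma> m \<longleftrightarrow>
     fst (\<gamma> ! m) = fst (\<gamma> ! (m - 1)) + 1 \<and> snd (\<gamma> ! m) + 1 = snd (\<gamma> ! (m - 1))"

definition dyck_path :: "nat \<Rightarrow> (nat \<times> nat) list \<Rightarrow> bool" where
  "dyck_path n \<gamma> \<longleftrightarrow> length \<gamma> = 2*n + 1 \<and> \<gamma> ! 0 = (0, 0) \<and> \<gamma> ! (2*n) = (2*n, 0) \<and>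
     (\<forall>m\<in>{1..2*n}. up_step \<gamma> m \<or> down_step \<gamma> m)"

text \<open>The position \<open>m\<close> of the \<open>i\<close>-th down step from the left, counting \<open>i\<close> from 1.\<close>

definition down_pos :: "(nat \<times> nat) list \<Rightarrow> nat \<Rightarrow> nat" where
  "down_pos \<gamma> i = filter (down_step \<gamma>) [1..<length \<gamma>] ! (i - 1)"

text \<open>Half the height of the point with index \<open>2 j - 2\<close>, which is even on a Dyck path.
  It is an integer so that expressions such as \<open>k - 1\<close> are not truncated.\<close>

definition half_height :: "(nat \<times> nat) list \<Rightarrow> nat \<Rightarrow> int" where
  "half_height \<gamma> j = int (snd (\<gamma> ! (2*j - 2))) div 2"

definition n1 :: "(nat \<times> nat) list \<Rightarrow> nat \<Rightarrow> int" where
  "n1 \<xi> i = int (fst (\<xi> ! (i - 1)))"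

definition n2 :: "(nat \<times> nat) list \<Rightarrow> nat \<Rightarrow> int" where
  "n2 \<xi> i = int (snd (\<xi> ! (i - 1)))"

definition DH :: "nat \<Rightarrow> ((nat \<times> nat) list \<times> (nat \<times> nat) list) set" where
  "DH n = {(\<gamma>, \<xi>). dyck_path n \<gamma> \<and> length \<xi> = n \<and>
     (\<forall>j\<in>{1..n}. let k = half_height \<gamma> j in
        (\<forall>i\<in>{1..n}. down_pos \<gamma> i = 2*j - 1 \<and> up_step \<gamma> (2*j) \<longrightarrow>
           k \<ge> n1 \<xi> i \<and> n1 \<xi> i > n2 \<xi> i \<and> n2 \<xi> i \<ge> 0) \<and>
        (\<forall>i\<in>{1..n}. up_step \<gamma> (2*j - 1) \<and> down_pos \<gamma> i = 2*j \<longrightarrow>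
           0 \<le> n1 \<xi> i \<and> n1 \<xi> i \<le> n2 \<xi> i \<and> n2 \<xi> i \<le> k) \<and>
        (\<forall>i\<in>{1..<n}. down_pos \<gamma> i = 2*j - 1 \<and> down_pos \<gamma> (i + 1) = 2*j \<longrightarrow>
           k - 1 \<ge> n1 \<xi> i \<and> n1 \<xi> i \<ge> n2 \<xi> i \<and> n2 \<xi> i \<ge> 0 \<and>
           0 \<le> n1 \<xi> (i + 1) \<and> n1 \<xi> (i + 1) \<le> n2 \<xi> (i + 1) \<and> n2 \<xi> (i + 1) \<le> k - 1))}"

text \<open>The indeterminate \<open>q\<close> lives in a ring in which it is invertible, so that
  \<open>q powi e\<close> determines the integer \<open>e\<close> and no exponent has to be truncated.\<close>

abbreviation q_var :: "rat fls" where
  "q_var \<equiv> fls_X"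

text \<open>The \<open>i\<close>-th down step \<open>m\<close> belongs to the pair of steps \<open>2 j - 1\<close>, \<open>2 j\<close>; the last two
  branches are the first and the second step of a pair of down steps.\<close>

definition step_weight :: "(nat \<times> nat) list \<Rightarrow> (nat \<times> nat) list \<Rightarrow> nat \<Rightarrow> rat fls" where
  "step_weight \<gamma> \<xi> i =
     (let m = down_pos \<gamma> i; j = (m + 1) div 2; k = half_height \<gamma> j in
      if m = 2*j - 1 \<and> up_step \<gamma> (2*j) then q_var powi (2*k - n1 \<xi> i - n2 \<xi> i)
      else if m = 2*j \<and> up_step \<gamma> (2*j - 1) then q_var powi (2*k - n1 \<xi> i - n2 \<xi> i)
      else if m = 2*j - 1 then q_var powi (2*k - 1 - n1 \<xi> i - n2 \<xi> i)
      else q_var powi (2*k - 2 - n1 \<xi> i - n2 \<xi> i))"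

definition weight :: "nat \<Rightarrow> (nat \<times> nat) list \<times> (nat \<times> nat) list \<Rightarrow> rat fls" where
  "weight n H = (\<Prod>i=1..n. step_weight (fst H) (snd H) i)"

end

theory Submission
  imports Defs "HOL-Library.FuncSet"
begin

text \<open>
  Both sides are summed with respect to the weight, and a bijection is then chosen inside each
  weight class. Let \<open>p = 1/q\<close>.

  Let \<open>c j\<close> be the number of dots of column \<open>j\<close> in the rows \<open>1, \<dots>, n\<close>, and let
  \<open>k = c 1 + \<dots> + c (j - 1) - (j - 1)\<close>. For fixed \<open>c\<close> the lower and the upper half of a
  configuration are independent. Filling the lower rows from the last column to the first and the
  upper rows from the first column to the last, column \<open>j\<close> selects \<open>c j\<close> of \<open>k + c j\<close> lower rows
  and \<open>2 - c j\<close> of \<open>k + 1\<close> upper rows, so that configurations are counted by products of Gaussian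
  binomial coefficients along the path of the levels \<open>k\<close>.

  On the other side the labels of a pair of steps at half-height \<open>k\<close> can be summed locally. The pairs
  up-down and down-up together give \<open>q\<^sup>2\<^sup>k [k+1]\<^sub>p\<^sup>2\<close>, because pairs \<open>a \<le> b\<close> and pairs \<open>a > b\<close>
  make up a full square, which is the contribution of a column with \<open>c j = 1\<close>; a pair of
  down steps gives a square of a Gaussian binomial coefficient, whose two factors are the contributions
  of a column with \<open>c j = 0\<close> and of the matching column with \<open>c j = 2\<close>.
\<close>

section \<open>Equidistribution and Gaussian binomial coefficients\<close>

lemma fls_X_powi_nth: "fls_nth (fls_X powi e :: 'a::field fls) m = (if m = e then 1 else 0)"
proof -
  have "fls_X powi e = (fls_X_intpow e :: 'a fls)"
    by (simp add: fls_X_power_int)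
  then show ?thesis by simp
qed

text \<open>Comparing the coefficients of \<open>fls_X powi e\<close> shows that the fibres of
  \<open>f\<close> and \<open>g\<close> over each exponent \<open>e\<close> have equal cardinality,
  which a \<open>rat\<close> coefficient determines because the characteristic is 0. Bijections
  between the fibres then glue to one between \<open>A\<close> and \<open>B\<close>.\<close>

lemma bij_betw_of_sum_powi_eq:
  fixes f :: "'a \<Rightarrow> int" and g :: "'b \<Rightarrow> int"
  assumes A: "finite A" and B: "finite B"
    and eq: "(\<Sum>a\<in>A. fls_X powi f a :: rat fls) = (\<Sum>b\<in>B. fls_X powi g b)"
  shows "\<exists>\<Phi>. bij_betw \<Phi> A B \<and> (\<forall>a\<in>A. g (\<Phi> a) = f a)"
proof -
  have "card {a\<in>A. f a = e} = card {b\<in>B. g b = e}" for e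
  proof -
    have "(\<Sum>a\<in>A. if e = f a then 1 else (0::rat)) = (\<Sum>b\<in>B. if e = g b then 1 else 0)"
      using arg_cong[OF eq, of "\<lambda>F. fls_nth F e"] by (simp add: fls_X_powi_nth fls_nth_sum)
    then have "rat_of_nat (card {a\<in>A. f a = e}) = rat_of_nat (card {b\<in>B. g b = e})"
      using A B by (simp add: sum.If_cases Int_def eq_commute[of e])
    then show ?thesis by simp
  qed
  then have "\<forall>e. \<exists>h. bij_betw h {a\<in>A. f a = e} {b\<in>B. g b = e}"
    using A B by (auto intro!: finite_same_card_bij)
  then obtain h where h: "\<And>e. bij_betw (h e) {a\<in>A. f a = e} {b\<in>B. g b = e}" by metis
  have hB: "h (f a) a \<in> B \<and> g (h (f a) a) = f a" if "a \<in> A" for a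
    using bij_betwE[OF h[of "f a"]] that by blast
  have "inj_on (\<lambda>a. h (f a) a) A"
  proof (rule inj_onI)
    fix x y assume xy: "x \<in> A" "y \<in> A" "h (f x) x = h (f y) y"
    then have "f x = f y" using hB by metis
    then show "x = y"
      using xy bij_betw_imp_inj_on[OF h[of "f x"]] by (auto dest: inj_onD)
  qed
  moreover have "(\<lambda>a. h (f a) a) ` A = B"
  proof
    show "(\<lambda>a. h (f a) a) ` A \<subseteq> B" using hB by auto
    show "B \<subseteq> (\<lambda>a. h (f a) a) ` A"
    proof
      fix b assume "b \<in> B"
      then have "b \<in> h (g b) ` {a\<in>A. f a = g b}"
        using bij_betw_imp_surj_on[OF h[of "g b"]] by simp
      then show "b \<in> (\<lambda>a. h (f a) a) ` A" by force
    qed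
  qed
  ultimately have "bij_betw (\<lambda>a. h (f a) a) A B" by (simp add: bij_betw_def)
  then show ?thesis using hB by blast
qed

text \<open>Gaussian binomial coefficients; the truncation in \<open>m - c\<close> is harmless since
  \<open>qbin p m c = 0\<close> for \<open>m < c\<close>.\<close>

fun qbin :: "'a::comm_ring_1 \<Rightarrow> nat \<Rightarrow> nat \<Rightarrow> 'a" where
  "qbin p m 0 = 1"
| "qbin p 0 (Suc c) = 0"
| "qbin p (Suc m) (Suc c) = p ^ (m - c) * qbin p m c + qbin p m (Suc c)"

text \<open>With \<open>T\<close> the complement of \<open>S\<close> in a set of positions, these
  are the inversions created when the positions in \<open>S\<close> receive the larger of two
  letters and the others the smaller.\<close>

definition ascents :: "nat set \<Rightarrow> nat set \<Rightarrow> (nat \<times> nat) set" where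
  "ascents S T = {(a, b). a \<in> S \<and> b \<in> T \<and> a < b}"

lemma qbin_eq_0: "m < c \<Longrightarrow> qbin p m c = 0"
  by (induction p m c rule: qbin.induct) auto

lemma finite_ascents [simp]: "finite S \<Longrightarrow> finite T \<Longrightarrow> finite (ascents S T)"
  by (rule finite_subset[of _ "S \<times> T"]) (auto simp: ascents_def)

text \<open>Elements are added in decreasing order, so the new \<open>x\<close> lies below all of
  \<open>Q\<close>. If \<open>x\<close> is chosen, it forms an ascent with every unchosen element of
  \<open>Q\<close>; otherwise it forms none. These are the two terms in the recursion of
  \<open>qbin\<close>.\<close>

lemma sum_subsets_qbin:
  assumes "finite Q"
  shows "(\<Sum>S | S \<subseteq> Q \<and> card S = c. p ^ card (ascents S (Q - S))) = qbin p (card Q) c"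
  using assms
proof (induction Q arbitrary: c rule: finite_linorder_min_induct)
  case empty
  have "{S::nat set. S \<subseteq> {} \<and> card S = c} = (if c = 0 then {{}} else {})" by auto
  then show ?case by (cases c) (simp_all only: card.empty qbin.simps ascents_def, simp_all)
next
  case (insert x Q)
  have xQ: "x \<notin> Q" using insert.hyps by auto
  show ?case
  proof (cases c)
    case 0
    have "{S. S \<subseteq> insert x Q \<and> card S = 0} = {{}}"
      using insert.hyps by (auto simp: card_eq_0_iff dest: finite_subset)
    then show ?thesis using 0 by (simp add: ascents_def)
  next
    case (Suc d)
    let ?A = "{S. S \<subseteq> Q \<and> card S = d}" and ?B = "{S. S \<subseteq> Q \<and> card S = Suc d}"
    have fin: "finite S" if "S \<subseteq> Q" for S using that insert.hyps finite_subset by blast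
    have split: "{S. S \<subseteq> insert x Q \<and> card S = c} = insert x ` ?A \<union> ?B"
    proof (intro set_eqI iffI)
      fix S assume "S \<in> {S. S \<subseteq> insert x Q \<and> card S = c}"
      then have S: "S \<subseteq> insert x Q" "card S = Suc d" using Suc by auto
      show "S \<in> insert x ` ?A \<union> ?B"
      proof (cases "x \<in> S")
        case True
        have "finite S" using S by (metis card.infinite nat.distinct(1))
        then have "S = insert x (S - {x})" "card (S - {x}) = d" "S - {x} \<subseteq> Q"
          using S True by auto
        then show ?thesis by blast
      qed (use S in auto)
    qed (use xQ Suc fin in \<open>auto intro!: card_insert_disjoint\<close>)
    have inj: "inj_on (insert x) ?A"
      using xQ by (intro inj_onI) (metis (mono_tags) insert_ident mem_Collect_eq subset_iff)
    have "card (ascents (insert x S) (insert x Q - insert x S)) = card (ascents S (Q - S)) + (card Q - d)"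
      if "S \<in> ?A" for S
    proof -
      have "ascents (insert x S) (insert x Q - insert x S) = ascents S (Q - S) \<union> Pair x ` (Q - S)"
        using xQ insert.hyps by (auto simp: ascents_def)
      moreover have "ascents S (Q - S) \<inter> Pair x ` (Q - S) = {}"
        using xQ that by (auto simp: ascents_def)
      moreover have "card (Pair x ` (Q - S)) = card Q - d"
        using that insert.hyps fin by (simp add: card_image card_Diff_subset inj_on_def)
      ultimately show ?thesis
        using insert.hyps that fin by (simp add: card_Un_disjoint)
    qed
    then have 1: "(\<Sum>S\<in>insert x ` ?A. p ^ card (ascents S (insert x Q - S)))
        = p ^ (card Q - d) * (\<Sum>S\<in>?A. p ^ card (ascents S (Q - S)))"
      by (simp add: sum.reindex[OF inj] sum_distrib_left power_add mult.commute)
    have "ascents S (insert x Q - S) = ascents S (Q - S)" if "S \<in> ?B" for S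
      using insert.hyps that by (fastforce simp: ascents_def)
    then have 2: "(\<Sum>S\<in>?B. p ^ card (ascents S (insert x Q - S)))
        = (\<Sum>S\<in>?B. p ^ card (ascents S (Q - S)))" by simp
    have "(\<Sum>S | S \<subseteq> insert x Q \<and> card S = c. p ^ card (ascents S (insert x Q - S)))
        = (\<Sum>S\<in>insert x ` ?A. p ^ card (ascents S (insert x Q - S)))
          + (\<Sum>S\<in>?B. p ^ card (ascents S (insert x Q - S)))"
      unfolding split using xQ insert.hyps by (intro sum.union_disjoint) auto
    also have "\<dots> = p ^ (card Q - d) * qbin p (card Q) d + qbin p (card Q) (Suc d)"
      unfolding 1 2 using insert.IH by simp
    finally show ?thesis using Suc xQ insert.hyps by simp
  qed
qed

lemma qbin_1: "qbin p (Suc k) (Suc 0) = (\<Sum>a\<le>k. p ^ a)"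
  by (induction k) auto

text \<open>Weakly ordered pairs are the shape in which the labels of a history occur. The recursion
  of \<open>qbin\<close> splits off the row with the largest \<open>b\<close>.\<close>

lemma qbin_2: "qbin p (k + 2) 2 = (\<Sum>b\<le>k. \<Sum>a\<le>b. p ^ (a + b))"
proof (induction k)
  case 0
  then show ?case by (simp add: numeral_2_eq_2)
next
  case (Suc k)
  have "qbin p (Suc k + 2) 2 = p ^ Suc k * qbin p (Suc (Suc k)) (Suc 0) + qbin p (k + 2) 2"
    by (simp add: numeral_2_eq_2)
  also have "\<dots> = (\<Sum>b\<le>Suc k. \<Sum>a\<le>b. p ^ (a + b))"
    unfolding Suc.IH qbin_1 by (simp add: sum_distrib_left power_add algebra_simps)
  finally show ?case .
qed

section \<open>Words below the diagonal\<close>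

definition inversions :: "nat set \<Rightarrow> (nat \<Rightarrow> nat) \<Rightarrow> (nat \<times> nat) set" where
  "inversions I L = {(a, b). a \<in> I \<and> b \<in> I \<and> a < b \<and> L b < L a}"

lemma finite_inversions [simp]: "finite I \<Longrightarrow> finite (inversions I L)"
  by (rule finite_subset[of _ "I \<times> I"]) (auto simp: inversions_def)

text \<open>All letters up to \<open>j\<close> are identified with \<open>j\<close>.\<close>

definition subdiag :: "nat \<Rightarrow> (nat \<Rightarrow> nat) \<Rightarrow> nat \<Rightarrow> (nat \<Rightarrow> nat) set" where
  "subdiag n c j = {L \<in> {1..n} \<rightarrow>\<^sub>E {j..n}. (\<forall>i\<in>{1..n}. L i \<le> max i j) \<and>
     (\<forall>l\<in>{j<..n}. card {i\<in>{1..n}. L i = l} = c l)}"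

lemma finite_subdiag [simp]: "finite (subdiag n c j)"
  by (rule finite_subset[of _ "{1..n} \<rightarrow>\<^sub>E {j..n}"]) (auto simp: subdiag_def intro: finite_PiE)

text \<open>\<open>subdiag\<close> prescribes only the multiplicities of the letters above
  \<open>j\<close>; that of \<open>j\<close> follows because there are \<open>n\<close> positions in
  total.\<close>

lemma card_bottom_letter:
  assumes L: "L \<in> subdiag n c j"
  shows "card {i\<in>{1..n}. L i = j} + (\<Sum>l\<in>{j<..n}. c l) = n"
proof (cases "j \<le> n")
  case True
  have "L i \<in> {j..n}" if "i \<in> {1..n}" for i using L that unfolding subdiag_def by (auto dest!: PiE_mem)
  then have "card {1..n} = (\<Sum>l\<in>{j..n}. card {i\<in>{1..n}. L i = l})"
    using sum.group[of "{1..n}" "{j..n}" L "\<lambda>_. 1::nat"] by (simp add: image_subset_iff)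
  also have "{j..n} = insert j {j<..n}" using True by auto
  also have "(\<Sum>l\<in>insert j {j<..n}. card {i\<in>{1..n}. L i = l})
      = card {i\<in>{1..n}. L i = j} + (\<Sum>l\<in>{j<..n}. card {i\<in>{1..n}. L i = l})" by simp
  also have "(\<Sum>l\<in>{j<..n}. card {i\<in>{1..n}. L i = l}) = (\<Sum>l\<in>{j<..n}. c l)"
    using L by (intro sum.cong) (auto simp: subdiag_def)
  finally show ?thesis by simp
next
  case False
  \<comment> \<open>For \<open>n < j\<close> the alphabet \<open>{j..n}\<close> is empty, so a word
    exists only if there are no positions.\<close>
  then have "n = 0" using L by (auto simp: subdiag_def PiE_iff) 
  then show ?thesis using False by simp
qed

text \<open>Merging the letters \<open>j\<close> and \<open>j + 1\<close> of a word forgets exactly which occurrences of the merged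
  letter, all but the first \<open>j\<close> of which are eligible, were a \<open>j + 1\<close>.\<close>

lemma sum_subdiag_step:
  fixes p :: "'a::comm_ring_1"
  assumes j: "j < n"
  shows "(\<Sum>L\<in>subdiag n c j. p ^ card (inversions {1..n} L)) =
    qbin p (n - (\<Sum>l\<in>{Suc j<..n}. c l) - j) (c (Suc j)) *
    (\<Sum>L\<in>subdiag n c (Suc j). p ^ card (inversions {1..n} L))"
proof -
  \<comment> \<open>\<open>F\<close> merges the letters \<open>j\<close> and \<open>j + 1\<close>.
    \<open>G\<close> separates them again, given the set \<open>S\<close> of positions in
    \<open>Q L\<close> that keep the letter \<open>j + 1\<close>; \<open>P L\<close> collects the
    admissible \<open>S\<close>.\<close>
  define Q where "Q L = {i\<in>{Suc j..n}. L i = Suc j}" for L :: "nat \<Rightarrow> nat"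
  define P where "P L = {S. S \<subseteq> Q L \<and> card S = c (Suc j)}" for L
  define F where "F L = (\<lambda>i\<in>{1..n}. max (Suc j) (L i))" for L :: "nat \<Rightarrow> nat"
  define G where "G L S = (\<lambda>i\<in>{1..n}. if L i = Suc j \<and> i \<notin> S then j else L i)"
    for L :: "nat \<Rightarrow> nat" and S
  have finQ: "finite (Q L)" for L by (simp add: Q_def)
  have finP: "finite (P L)" for L using finQ by (simp add: P_def)
  have cardQ: "card (Q L) = n - (\<Sum>l\<in>{Suc j<..n}. c l) - j" if L: "L \<in> subdiag n c (Suc j)" for L
  proof -
    have "Suc j \<le> L i \<and> L i \<le> max i (Suc j)" if "i \<in> {1..n}" for i
      using L that by (auto simp: subdiag_def PiE_iff)
    \<comment> \<open>Here \<open>max i (Suc j) = Suc j\<close>. These positions must become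
      \<open>j\<close> when the letters are separated, so they are not eligible.\<close>
    then have small: "L i = Suc j" if "i \<in> {1..j}" for i using that j by force
    have "{i\<in>{1..n}. L i = Suc j} = Q L \<union> {1..j}" using small j by (auto simp: Q_def)
    moreover have "Q L \<inter> {1..j} = {}" by (auto simp: Q_def)
    ultimately have "card {i\<in>{1..n}. L i = Suc j} = card (Q L) + j"
      using finQ by (simp add: card_Un_disjoint)
    then show "card (Q L) = n - (\<Sum>l\<in>{Suc j<..n}. c l) - j"
      using card_bottom_letter[OF L] by simp
  qed
  have Fin: "F L \<in> subdiag n c (Suc j) \<and> {i\<in>{1..n}. L i = Suc j} \<in> P (F L)
      \<and> G (F L) {i\<in>{1..n}. L i = Suc j} = L" if L: "L \<in> subdiag n c j" for L
  proof (intro conjI)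
    have L1: "\<And>i. i \<in> {1..n} \<Longrightarrow> j \<le> L i \<and> L i \<le> n \<and> L i \<le> max i j" and ext: "L \<in> extensional {1..n}"
      and L2: "\<And>l. l \<in> {j<..n} \<Longrightarrow> card {i\<in>{1..n}. L i = l} = c l"
      using L by (auto simp: subdiag_def PiE_iff)
    have "{i\<in>{1..n}. F L i = l} = {i\<in>{1..n}. L i = l}" if "l \<in> {Suc j<..n}" for l
      using that by (auto simp: F_def max_def)
    moreover have "F L i \<le> max i (Suc j)" "F L i \<in> {Suc j..n}" if "i \<in> {1..n}" for i
      using L1[OF that] that j by (auto simp: F_def)
    ultimately show "F L \<in> subdiag n c (Suc j)"
      using L2 by (auto simp: subdiag_def PiE_iff F_def extensional_def)
    have "i \<ge> Suc j" if "i \<in> {1..n}" "L i = Suc j" for i using L1[OF that(1)] that by auto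
    then show "{i\<in>{1..n}. L i = Suc j} \<in> P (F L)"
      using L2[of "Suc j"] j by (auto simp: P_def Q_def F_def)
    show "G (F L) {i\<in>{1..n}. L i = Suc j} = L"
    proof
      fix i show "G (F L) {i\<in>{1..n}. L i = Suc j} i = L i"
        using L1[of i] ext by (cases "i \<in> {1..n}") (auto simp: F_def G_def extensional_def max_def)
    qed
  qed
  have Gin: "G L S \<in> subdiag n c j \<and> F (G L S) = L \<and> {i\<in>{1..n}. G L S i = Suc j} = S \<and>
      card (inversions {1..n} (G L S)) = card (inversions {1..n} L) + card (ascents S (Q L - S))"
    if L: "L \<in> subdiag n c (Suc j)" and S: "S \<in> P L" for L S
  proof (intro conjI)
    have L1: "\<And>i. i \<in> {1..n} \<Longrightarrow> Suc j \<le> L i \<and> L i \<le> n \<and> L i \<le> max i (Suc j)" and ext: "L \<in> extensional {1..n}"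
      and L2: "\<And>l. l \<in> {Suc j<..n} \<Longrightarrow> card {i\<in>{1..n}. L i = l} = c l"
      using L by (auto simp: subdiag_def PiE_iff)
    have S1: "i \<in> {1..n} \<and> Suc j \<le> i \<and> L i = Suc j" if "i \<in> S" for i
      using S that by (auto simp: P_def Q_def)
    show SG: "{i\<in>{1..n}. G L S i = Suc j} = S" using S1 by (auto simp: G_def split: if_splits)
    have "{i\<in>{1..n}. G L S i = l} = {i\<in>{1..n}. L i = l}" if "l \<in> {Suc j<..n}" for l
      using that by (auto simp: G_def)
    then have "card {i\<in>{1..n}. G L S i = l} = c l" if "l \<in> {j<..n}" for l
      using that L2 SG S by (cases "l = Suc j") (auto simp: P_def)
    moreover have "G L S i \<le> max i j \<and> G L S i \<in> {j..n}" if "i \<in> {1..n}" for i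
      using L1[OF that] S1[of i] that j by (auto simp: G_def)
    ultimately show "G L S \<in> subdiag n c j"
      by (auto simp: subdiag_def PiE_iff G_def extensional_def)
    show "F (G L S) = L"
    proof
      fix i show "F (G L S) i = L i"
        using L1[of i] ext by (cases "i \<in> {1..n}") (auto simp: F_def G_def extensional_def max_def)
    qed
    \<comment> \<open>All letters other than the merged one exceed \<open>Suc j\<close>, so
      separation only adds inversions between a position of \<open>S\<close> and a later position
      lowered to \<open>j\<close>. The positions up to \<open>j\<close> precede all of
      \<open>S\<close>, so the later position lies in \<open>Q L - S\<close>.\<close>
    have "inversions {1..n} (G L S) = inversions {1..n} L \<union> ascents S (Q L - S)"
    proof (intro set_eqI iffI)
      fix x assume x: "x \<in> inversions {1..n} (G L S)"
      obtain a b where [simp]: "x = (a, b)" by (cases x)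
      have ab: "a \<in> {1..n}" "b \<in> {1..n}" "a < b" "G L S b < G L S a" using x by (auto simp: inversions_def)
      show "x \<in> inversions {1..n} L \<union> ascents S (Q L - S)"
        using ab L1[of a] L1[of b] S1[of a]
        by (auto simp: G_def inversions_def ascents_def Q_def split: if_splits)
    next
      fix x assume x: "x \<in> inversions {1..n} L \<union> ascents S (Q L - S)"
      obtain a b where [simp]: "x = (a, b)" by (cases x)
      show "x \<in> inversions {1..n} (G L S)"
        using x L1[of a] L1[of b] S1[of a]
        by (auto simp: G_def inversions_def ascents_def Q_def)
    qed
    moreover have "inversions {1..n} L \<inter> ascents S (Q L - S) = {}"
      using S1 by (auto simp: inversions_def ascents_def Q_def)
    moreover have "finite S" using S finQ[of L] finite_subset by (auto simp: P_def)
    ultimately show "card (inversions {1..n} (G L S)) = card (inversions {1..n} L) + card (ascents S (Q L - S))"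
      using finQ by (simp add: card_Un_disjoint)
  qed
  have "(\<Sum>L\<in>subdiag n c j. p ^ card (inversions {1..n} L)) =
      (\<Sum>(L, S)\<in>Sigma (subdiag n c (Suc j)) P. p ^ (card (inversions {1..n} L) + card (ascents S (Q L - S))))"
  proof (rule sum.reindex_bij_witness[of _ "\<lambda>(L, S). G L S" "\<lambda>L. (F L, {i\<in>{1..n}. L i = Suc j})"])
    fix L assume L: "L \<in> subdiag n c j"
    let ?S = "{i\<in>{1..n}. L i = Suc j}"
    note 1 = Fin[OF L]
    show "(case (F L, ?S) of (L, S) \<Rightarrow> G L S) = L" "(F L, ?S) \<in> Sigma (subdiag n c (Suc j)) P"
      using 1 by auto
    show "(case (F L, ?S) of (L, S) \<Rightarrow> p ^ (card (inversions {1..n} L) + card (ascents S (Q L - S))))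
        = p ^ card (inversions {1..n} L)"
      using 1 Gin[of "F L" ?S] by (simp del: atLeastAtMost_iff)
  next
    fix x assume "x \<in> Sigma (subdiag n c (Suc j)) P"
    then obtain L S where x: "x = (L, S)" "L \<in> subdiag n c (Suc j)" "S \<in> P L" by auto
    then show "(F (case x of (L, S) \<Rightarrow> G L S), {i\<in>{1..n}. (case x of (L, S) \<Rightarrow> G L S) i = Suc j}) = x"
      "(case x of (L, S) \<Rightarrow> G L S) \<in> subdiag n c j"
      using Gin[OF x(2,3)] by (simp_all del: atLeastAtMost_iff)
  qed
  also have "\<dots> = (\<Sum>L\<in>subdiag n c (Suc j). \<Sum>S\<in>P L. p ^ (card (inversions {1..n} L) + card (ascents S (Q L - S))))"
    using finP by (simp add: sum.Sigma)
  also have "\<dots> = (\<Sum>L\<in>subdiag n c (Suc j). p ^ card (inversions {1..n} L) * qbin p (card (Q L)) (c (Suc j)))"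
    by (simp add: power_add sum_distrib_left[symmetric] P_def sum_subsets_qbin finQ)
  also have "\<dots> = (\<Sum>L\<in>subdiag n c (Suc j). p ^ card (inversions {1..n} L) *
      qbin p (n - (\<Sum>l\<in>{Suc j<..n}. c l) - j) (c (Suc j)))"
    using cardQ by simp
  finally show ?thesis by (simp add: sum_distrib_left mult.commute)
qed


text \<open>Letters are merged one at a time until only a constant word remains, which has no
  inversions. Since \<open>c\<close> sums to \<open>n\<close>, complements of tail sums become
  prefix sums.\<close>

lemma sum_subdiag:
  fixes p :: "'a::comm_ring_1"
  assumes c: "(\<Sum>l\<in>{1..n}. c l) = n"
  shows "(\<Sum>L\<in>subdiag n c 0. p ^ card (inversions {1..n} L)) =
    (\<Prod>j<n. qbin p ((\<Sum>l\<in>{1..Suc j}. c l) - j) (c (Suc j)))"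
proof -
  have *: "n - (\<Sum>l\<in>{Suc j<..n}. c l) = (\<Sum>l\<in>{1..Suc j}. c l)" if "j < n" for j
  proof -
    have "{1..n} = {1..Suc j} \<union> {Suc j<..n}" using that by auto
    then have "(\<Sum>l\<in>{1..n}. c l) = (\<Sum>l\<in>{1..Suc j}. c l) + (\<Sum>l\<in>{Suc j<..n}. c l)"
      by (metis sum.union_disjoint finite_atLeastAtMost finite_greaterThanAtMost ivl_disj_int_two(8))
    then show ?thesis using c by simp
  qed
  have main: "(\<Sum>L\<in>subdiag n c 0. p ^ card (inversions {1..n} L)) =
      (\<Prod>j<m. qbin p ((\<Sum>l\<in>{1..Suc j}. c l) - j) (c (Suc j))) *
      (\<Sum>L\<in>subdiag n c m. p ^ card (inversions {1..n} L))" if "m \<le> n" for m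
    using that
  proof (induction m)
    case (Suc m)
    then show ?case
      using sum_subdiag_step[of m n p c] *[of m] by (simp add: mult.assoc)
  qed simp
  have "subdiag n c n = {\<lambda>i\<in>{1..n}. n}"
    by (auto simp: subdiag_def PiE_iff extensional_def fun_eq_iff)
  moreover have "inversions {1..n} (\<lambda>i\<in>{1..n}. n) = {}" by (auto simp: inversions_def)
  ultimately show ?thesis using main[of n] by simp
qed

section \<open>Dellac configurations as words\<close>

text \<open>The word sends each row to the column of its dot.\<close>

definition dellac_words :: "nat \<Rightarrow> (nat \<Rightarrow> nat) set" where
  "dellac_words n = {r \<in> {1..2*n} \<rightarrow>\<^sub>E {1..n}. (\<forall>i\<in>{1..2*n}. r i \<le> i \<and> i \<le> r i + n) \<and>
     (\<forall>j\<in>{1..n}. card {i\<in>{1..2*n}. r i = j} = 2)}"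

lemma finite_dellac_words [simp]: "finite (dellac_words n)"
  by (rule finite_subset[of _ "{1..2*n} \<rightarrow>\<^sub>E {1..n}"]) (auto simp: dellac_words_def intro: finite_PiE)

lemma finite_DC: "finite (DC n)"
  by (rule finite_subset[of _ "Pow ({1..n} \<times> {1..2*n})"]) (auto simp: DC_def)

text \<open>Each row holds exactly one dot, so a configuration is the graph of a function from rows
  to columns and \<open>THE\<close> picks out its value.\<close>

lemma sum_DC_dellac_words:
  "(\<Sum>C\<in>DC n. f (inv_DC C)) = (\<Sum>r\<in>dellac_words n. f (card (inversions {1..2*n} r)))"
proof (rule sum.reindex_bij_witness[of _ "\<lambda>r. (\<lambda>i. (r i, i)) ` {1..2*n}"
      "\<lambda>C. \<lambda>i\<in>{1..2*n}. THE j. (j, i) \<in> C"])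
  fix r assume r: "r \<in> dellac_words n"
  let ?C = "(\<lambda>i. (r i, i)) ` {1..2*n}"
  have r1: "\<And>i. i \<in> {1..2*n} \<Longrightarrow> 1 \<le> r i \<and> r i \<le> n \<and> r i \<le> i \<and> i \<le> r i + n"
    and ext: "r \<in> extensional {1..2*n}"
    and r2: "\<And>j. j \<in> {1..n} \<Longrightarrow> card {i\<in>{1..2*n}. r i = j} = 2"
    using r by (auto simp: dellac_words_def PiE_iff)
  have "{j. (j, i) \<in> ?C} = {r i}" if "i \<in> {1..2*n}" for i using that by auto
  moreover have "{i. (j, i) \<in> ?C} = {i\<in>{1..2*n}. r i = j}" for j by auto
  ultimately show "?C \<in> DC n" using r1 r2 by (fastforce simp: DC_def)
  show "(\<lambda>i\<in>{1..2*n}. THE j. (j, i) \<in> ?C) = r"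
    using ext by (intro extensionalityI[of _ "{1..2*n}"]) auto
next
  fix C assume C: "C \<in> DC n"
  define r where "r = (\<lambda>i\<in>{1..2*n}. THE j. (j, i) \<in> C)"
  have sub: "C \<subseteq> {1..n} \<times> {1..2*n}" and col: "\<And>j. j \<in> {1..n} \<Longrightarrow> card {i. (j, i) \<in> C} = 2"
    and diag: "\<And>i j. (j, i) \<in> C \<Longrightarrow> j \<le> i \<and> i \<le> j + n"
    using C by (auto simp: DC_def)
  have "(j, i) \<in> C \<longleftrightarrow> j = r i" if "i \<in> {1..2*n}" for i j
  proof -
    have "card {j. (j, i) \<in> C} = 1" using C that by (auto simp: DC_def)
    then obtain x where "{j. (j, i) \<in> C} = {x}" by (auto simp: card_1_singleton_iff)
    then have x: "\<And>j. (j, i) \<in> C \<longleftrightarrow> j = x" by auto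
    then have "r i = x" using that by (simp add: r_def)
    then show ?thesis using x by simp
  qed
  then have r: "(j, i) \<in> C \<longleftrightarrow> i \<in> {1..2*n} \<and> j = r i" for i j
    using sub by blast
  have "r \<in> extensional {1..2*n}" by (simp add: r_def)
  moreover have "{i\<in>{1..2*n}. r i = j} = {i. (j, i) \<in> C}" for j
    by (auto simp: r simp del: atLeastAtMost_iff)
  moreover have "r i \<in> {1..n} \<and> r i \<le> i \<and> i \<le> r i + n" if "i \<in> {1..2*n}" for i
    using r that sub diag by blast
  ultimately have "r \<in> dellac_words n"
    using col by (auto simp: dellac_words_def PiE_iff simp del: atLeastAtMost_iff)
  moreover have "(\<lambda>i. (r i, i)) ` {1..2*n} = C" using r by (auto simp del: atLeastAtMost_iff)
  \<comment> \<open>An inversion of a configuration lists the dot in the smaller column first, which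
    is the one in the higher row; hence the swap.\<close>
  moreover have "bij_betw (\<lambda>(a, b). ((r b, b), (r a, a))) (inversions {1..2*n} r)
      {((j1, i1), (j2, i2)). (j1, i1) \<in> C \<and> (j2, i2) \<in> C \<and> j1 < j2 \<and> i1 > i2}"
    by (rule bij_betwI[where g = "\<lambda>((j1, i1), (j2, i2)). (i2, i1)"])
      (auto simp: inversions_def r simp del: atLeastAtMost_iff)
  then have "card (inversions {1..2*n} r) = inv_DC C"
    unfolding inv_DC_def by (rule bij_betw_same_card)
  ultimately show "(\<lambda>i. ((\<lambda>i\<in>{1..2*n}. THE j. (j, i) \<in> C) i, i)) ` {1..2*n} = C"
      "(\<lambda>i\<in>{1..2*n}. THE j. (j, i) \<in> C) \<in> dellac_words n"
      "f (card (inversions {1..2*n} (\<lambda>i\<in>{1..2*n}. THE j. (j, i) \<in> C))) = f (inv_DC C)"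
    unfolding r_def[symmetric] by simp_all
qed

section \<open>Lower and upper halves of a configuration\<close>

definition contents :: "nat \<Rightarrow> nat \<Rightarrow> (nat \<Rightarrow> nat) set" where
  "contents n s = {c \<in> {1..n} \<rightarrow>\<^sub>E {..2}. sum c {1..n} = s}"

lemma finite_contents [simp]: "finite (contents n s)"
  by (rule finite_subset[of _ "{1..n} \<rightarrow>\<^sub>E {..2}"]) (auto simp: contents_def intro: finite_PiE)

definition lower_content :: "nat \<Rightarrow> (nat \<Rightarrow> nat) \<Rightarrow> nat \<Rightarrow> nat" where
  "lower_content n r = (\<lambda>j\<in>{1..n}. card {i\<in>{1..n}. r i = j})"

lemma card_upper_rows:
  assumes "card {i\<in>{1..2*n}. r i = j} = 2" "j \<in> {1..n}"
  shows "lower_content n r j \<le> 2" "card {i\<in>{n<..2*n}. r i = j} = 2 - lower_content n r j"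
proof -
  have "{i\<in>{1..2*n}. r i = j} = {i\<in>{1..n}. r i = j} \<union> {i\<in>{n<..2*n}. r i = j}" by auto
  moreover have "{i\<in>{1..n}. r i = j} \<inter> {i\<in>{n<..2*n}. r i = j} = {}" by auto
  ultimately have "card {i\<in>{1..n}. r i = j} + card {i\<in>{n<..2*n}. r i = j} = 2"
    using assms by (simp add: card_Un_disjoint)
  then show "lower_content n r j \<le> 2" "card {i\<in>{n<..2*n}. r i = j} = 2 - lower_content n r j"
    using assms by (auto simp: lower_content_def)
qed

lemma lower_content_in_contents:
  assumes r: "r \<in> dellac_words n"
  shows "lower_content n r \<in> contents n n"
proof -
  have "r i \<in> {1..n}" if "i \<in> {1..n}" for i using r that by (auto simp: dellac_words_def PiE_iff)
  then have "(\<Sum>j\<in>{1..n}. card {i\<in>{1..n}. r i = j}) = n"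
    using sum.group[of "{1..n}" "{1..n}" r "\<lambda>_. 1::nat"] by (simp add: image_subset_iff)
  then have "sum (lower_content n r) {1..n} = n" by (simp add: lower_content_def)
  moreover have "lower_content n r \<in> extensional {1..n}" by (simp add: lower_content_def)
  moreover have "lower_content n r j \<le> 2" if "j \<in> {1..n}" for j
    using r that by (auto simp: dellac_words_def intro: card_upper_rows)
  ultimately show ?thesis by (auto simp: contents_def PiE_iff)
qed

text \<open>A half-turn of the grid moves the upper rows to the lower ones and column
  \<open>Suc n - l\<close> to column \<open>l\<close>. As every column has two dots, this is the
  lower content of the turned configuration.\<close>

definition dual_content :: "nat \<Rightarrow> (nat \<Rightarrow> nat) \<Rightarrow> nat \<Rightarrow> nat" where
  "dual_content n c l = 2 - c (Suc n - l)"

text \<open>Substituting \<open>Suc n - l\<close> for \<open>l\<close> turns the left sum into the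
  number of upper dots in the columns after \<open>j\<close>. The identity is additive to avoid
  truncated subtraction.\<close>

lemma sum_dual_content:
  assumes c: "c \<in> contents n n" and j: "j \<le> n"
  shows "(\<Sum>l\<in>{1..n - j}. dual_content n c l) + n = 2 * (n - j) + (\<Sum>l\<in>{1..j}. c l)"
    and "(\<Sum>l\<in>{1..j}. c l) \<le> n"
proof -
  have "(\<Sum>l\<in>{1..n - j}. dual_content n c l) = (\<Sum>l\<in>{j<..n}. 2 - c l)"
    by (rule sum.reindex_bij_witness[of _ "\<lambda>l. Suc n - l" "\<lambda>l. Suc n - l"])
      (use j in \<open>auto simp: dual_content_def\<close>)
  moreover have "(\<Sum>l\<in>{j<..n}. 2 - c l) + (\<Sum>l\<in>{j<..n}. c l) = (\<Sum>l\<in>{j<..n}. 2)"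
    unfolding sum.distrib[symmetric] using c by (intro sum.cong) (auto simp: contents_def PiE_iff)
  moreover have "(\<Sum>l\<in>{1..j}. c l) + (\<Sum>l\<in>{j<..n}. c l) = n"
  proof -
    have "{1..n} = {1..j} \<union> {j<..n}" using j by auto
    then have "sum c {1..n} = (\<Sum>l\<in>{1..j}. c l) + (\<Sum>l\<in>{j<..n}. c l)"
      by (metis sum.union_disjoint finite_atLeastAtMost finite_greaterThanAtMost ivl_disj_int_two(8))
    then show ?thesis using c by (simp add: contents_def)
  qed
  ultimately show "(\<Sum>l\<in>{1..n - j}. dual_content n c l) + n = 2 * (n - j) + (\<Sum>l\<in>{1..j}. c l)"
    "(\<Sum>l\<in>{1..j}. c l) \<le> n" by simp_all
qed

text \<open>A lower dot in column \<open>j + 1\<close> is inverted with exactly the upper dots in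
  columns \<open>1\<close> to \<open>j\<close>; these columns have \<open>2 * j\<close> dots, from
  which the lower ones are subtracted.\<close>

lemma card_cross_inversions:
  assumes r: "r \<in> dellac_words n" and c: "c = lower_content n r"
  shows "card {(a, b). a \<in> {1..n} \<and> b \<in> {n<..2*n} \<and> r b < r a} =
    (\<Sum>j<n. c (Suc j) * (2 * j - (\<Sum>l\<in>{1..j}. c l)))"
proof -
  have r1: "\<And>i. i \<in> {1..2*n} \<Longrightarrow> r i \<in> {1..n}"
    and r2: "\<And>j. j \<in> {1..n} \<Longrightarrow> card {i\<in>{1..2*n}. r i = j} = 2"
    using r by (auto simp: dellac_words_def PiE_iff simp del: atLeastAtMost_iff)
  have below: "card {b\<in>{n<..2*n}. r b < Suc j} = 2 * j - (\<Sum>l\<in>{1..j}. c l)" if "j < n" for j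
  proof -
    let ?B = "{b\<in>{n<..2*n}. r b < Suc j}"
    have "r ` ?B \<subseteq> {1..j}" using r1 by fastforce
    then have "card ?B = (\<Sum>l\<in>{1..j}. card {b\<in>?B. r b = l})"
      using sum.group[of ?B "{1..j}" r "\<lambda>_. 1::nat"] by simp
    also have "\<dots> = (\<Sum>l\<in>{1..j}. 2 - c l)"
    proof (rule sum.cong[OF refl])
      fix l assume l: "l \<in> {1..j}"
      then have "{b\<in>?B. r b = l} = {b\<in>{n<..2*n}. r b = l}" by auto
      then show "card {b\<in>?B. r b = l} = 2 - c l" using card_upper_rows(2)[OF r2, of l] l that c by simp
    qed
    also have "\<dots> = 2 * j - (\<Sum>l\<in>{1..j}. c l)"
    proof -
      have "c l \<le> 2" if "l \<in> {1..j}" for l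
        using card_upper_rows(1)[OF r2, of l] that \<open>j < n\<close> c by simp
      then have "(\<Sum>l\<in>{1..j}. 2 - c l) + (\<Sum>l\<in>{1..j}. c l) = (\<Sum>l\<in>{1..j}. 2)"
        unfolding sum.distrib[symmetric] by (intro sum.cong) auto
      then show ?thesis by simp
    qed
    finally show ?thesis .
  qed
  have "{(a, b). a \<in> {1..n} \<and> b \<in> {n<..2*n} \<and> r b < r a} = Sigma {1..n} (\<lambda>a. {b\<in>{n<..2*n}. r b < r a})"
    by auto
  then have "card {(a, b). a \<in> {1..n} \<and> b \<in> {n<..2*n} \<and> r b < r a} = (\<Sum>a\<in>{1..n}. card {b\<in>{n<..2*n}. r b < r a})"
    by simp
  also have "\<dots> = (\<Sum>j\<in>{1..n}. \<Sum>a | a \<in> {1..n} \<and> r a = j. card {b\<in>{n<..2*n}. r b < r a})"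
    using r1 by (subst sum.group) auto
  also have "\<dots> = (\<Sum>j\<in>{1..n}. c j * card {b\<in>{n<..2*n}. r b < j})"
    by (intro sum.cong) (auto simp: c lower_content_def)
  also have "\<dots> = (\<Sum>j<n. c (Suc j) * card {b\<in>{n<..2*n}. r b < Suc j})"
    by (rule sum.reindex_bij_witness[of _ Suc "\<lambda>j. j - 1"]) auto
  finally show ?thesis using below by simp
qed

text \<open>Inversions are sorted by the halves containing their two positions. Reversing both
  positions and letters preserves inversions, so the upper half can be read as a word on
  \<open>{1..n}\<close>.\<close>

lemma card_inversions_halves:
  assumes r: "r \<in> {1..2*n} \<rightarrow> {1..n}"
  shows "card (inversions {1..2*n} r) = card (inversions {1..n} r)
    + card (inversions {1..n} (\<lambda>i. Suc n - r (Suc (2*n) - i)))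
    + card {(a, b). a \<in> {1..n} \<and> b \<in> {n<..2*n} \<and> r b < r a}"
proof -
  let ?X = "{(a, b). a \<in> {1..n} \<and> b \<in> {n<..2*n} \<and> r b < r a}"
  let ?U = "inversions {n<..2*n} r"
  have fin: "finite ?X" by (rule finite_subset[of _ "{1..n} \<times> {n<..2*n}"]) auto
  have "inversions {1..2*n} r = (inversions {1..n} r \<union> ?U) \<union> ?X"
    by (auto simp: inversions_def)
  moreover have "inversions {1..n} r \<inter> ?U = {}" "(inversions {1..n} r \<union> ?U) \<inter> ?X = {}"
    by (auto simp: inversions_def)
  ultimately have "card (inversions {1..2*n} r) = card (inversions {1..n} r) + card ?U + card ?X"
    using fin by (simp add: card_Un_disjoint)
  moreover have "bij_betw (\<lambda>(a, b). (Suc (2*n) - b, Suc (2*n) - a)) ?U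
      (inversions {1..n} (\<lambda>i. Suc n - r (Suc (2*n) - i)))"
  proof (rule bij_betwI[where g = "\<lambda>(a, b). (Suc (2*n) - b, Suc (2*n) - a)"])
    have r': "1 \<le> r i \<and> r i \<le> n" if "1 \<le> i" "i \<le> 2*n" for i using r that by fastforce
    show "(\<lambda>(a, b). (Suc (2*n) - b, Suc (2*n) - a)) \<in> ?U \<rightarrow>
        inversions {1..n} (\<lambda>i. Suc n - r (Suc (2*n) - i))"
    proof
      fix x assume x: "x \<in> ?U"
      obtain a b where [simp]: "x = (a, b)" by (cases x)
      show "(case x of (a, b) \<Rightarrow> (Suc (2*n) - b, Suc (2*n) - a)) \<in>
          inversions {1..n} (\<lambda>i. Suc n - r (Suc (2*n) - i))"
        using x r'[of a] r'[of b] by (auto simp: inversions_def)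
    qed
    show "(\<lambda>(a, b). (Suc (2*n) - b, Suc (2*n) - a)) \<in>
        inversions {1..n} (\<lambda>i. Suc n - r (Suc (2*n) - i)) \<rightarrow> ?U"
      by (auto simp: inversions_def)
  qed (auto simp: inversions_def)
  then have "card ?U = card (inversions {1..n} (\<lambda>i. Suc n - r (Suc (2*n) - i)))"
    by (rule bij_betw_same_card)
  ultimately show ?thesis by simp
qed

text \<open>The alphabet contains the letter \<open>0\<close>, but when \<open>c\<close> sums to
  \<open>n\<close> no position is left for it.\<close>

lemma subdiag_pos:
  assumes L: "L \<in> subdiag n c 0" and c: "sum c {1..n} = n" and i: "i \<in> {1..n}"
  shows "L i \<in> {1..n}"
proof -
  have "{0<..n} = {1..n}" by auto
  then have "card {i\<in>{1..n}. L i = 0} = 0" using card_bottom_letter[OF L] c by simp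
  then have "L i \<noteq> 0" using i by auto
  then show ?thesis using L i by (auto simp: subdiag_def PiE_iff)
qed

text \<open>For fixed content the number of cross inversions is constant and the halves are
  independent. The lower rows are constrained by \<open>r i \<le> i\<close>, the upper rows by
  \<open>i \<le> r i + n\<close>, which the half-turn transforms into the same subdiagonal
  condition.\<close>

lemma sum_dellac_words_content:
  fixes p :: "'a::comm_ring_1"
  assumes c: "c \<in> contents n n"
  shows "(\<Sum>r | r \<in> dellac_words n \<and> lower_content n r = c. p ^ card (inversions {1..2*n} r)) =
    p ^ (\<Sum>j<n. c (Suc j) * (2 * j - (\<Sum>l\<in>{1..j}. c l))) *
    ((\<Sum>L\<in>subdiag n c 0. p ^ card (inversions {1..n} L)) *
     (\<Sum>U\<in>subdiag n (dual_content n c) 0. p ^ card (inversions {1..n} U)))"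
proof -
  let ?W = "{r \<in> dellac_words n. lower_content n r = c}"
  let ?D = "subdiag n c 0 \<times> subdiag n (dual_content n c) 0"
  let ?x = "\<Sum>j<n. c (Suc j) * (2 * j - (\<Sum>l\<in>{1..j}. c l))"
  define F where "F r = (\<lambda>i\<in>{1..n}. r i, \<lambda>i\<in>{1..n}. Suc n - r (Suc (2*n) - i))" for r :: "nat \<Rightarrow> nat"
  define G where "G = (\<lambda>(L, U). \<lambda>i\<in>{1..2*n}. if i \<le> n then L i else Suc n - U (Suc (2*n) - i))"
    for L U :: "nat \<Rightarrow> nat"
  have inv_restrict: "inversions I (restrict f I) = inversions I f" for I f
    by (auto simp: inversions_def)
  have c1: "sum c {1..n} = n" "c \<in> extensional {1..n}" "\<And>j. j \<in> {1..n} \<Longrightarrow> c j \<le> 2"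
    using c by (auto simp: contents_def PiE_iff)
  have c2: "sum (dual_content n c) {1..n} = n"
    using sum_dual_content(1)[OF c, of 0] by simp
  have F: "F r \<in> ?D \<and> G (F r) = r \<and> card (inversions {1..2*n} r) =
      ?x + (card (inversions {1..n} (fst (F r))) + card (inversions {1..n} (snd (F r))))"
    if r: "r \<in> ?W" for r
  proof -
    have r1: "\<And>i. i \<in> {1..2*n} \<Longrightarrow> 1 \<le> r i \<and> r i \<le> n \<and> r i \<le> i \<and> i \<le> r i + n"
      and ext: "r \<in> extensional {1..2*n}"
      and r2: "\<And>j. j \<in> {1..n} \<Longrightarrow> card {i\<in>{1..2*n}. r i = j} = 2"
      and rc: "lower_content n r = c"
      using r by (auto simp: dellac_words_def PiE_iff)
    have "card {i\<in>{1..n}. fst (F r) i = l} = c l" if "l \<in> {0<..n}" for l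
    proof -
      have "{i\<in>{1..n}. fst (F r) i = l} = {i\<in>{1..n}. r i = l}" by (auto simp: F_def)
      then show ?thesis using rc that by (auto simp: lower_content_def)
    qed
    moreover have "card {i\<in>{1..n}. snd (F r) i = l} = dual_content n c l" if "l \<in> {0<..n}" for l
    proof -
      have l: "Suc n - l \<in> {1..n}" using that by auto
      have "bij_betw (\<lambda>i. Suc (2*n) - i) {i\<in>{1..n}. snd (F r) i = l} {i\<in>{n<..2*n}. r i = Suc n - l}"
      proof (rule bij_betwI[where g = "\<lambda>i. Suc (2*n) - i"])
        show "(\<lambda>i. Suc (2*n) - i) \<in> {i\<in>{1..n}. snd (F r) i = l} \<rightarrow> {i\<in>{n<..2*n}. r i = Suc n - l}"
        proof
          fix i assume "i \<in> {i\<in>{1..n}. snd (F r) i = l}"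
          then show "Suc (2*n) - i \<in> {i\<in>{n<..2*n}. r i = Suc n - l}"
            using r1[of "Suc (2*n) - i"] that by (auto simp: F_def)
        qed
        show "(\<lambda>i. Suc (2*n) - i) \<in> {i\<in>{n<..2*n}. r i = Suc n - l} \<rightarrow> {i\<in>{1..n}. snd (F r) i = l}"
          using that by (auto simp: F_def)
      qed auto
      then show ?thesis
        using card_upper_rows(2)[OF r2[OF l] l] rc by (simp add: bij_betw_same_card dual_content_def)
    qed
    moreover have "fst (F r) i \<le> i \<and> fst (F r) i \<le> n \<and> snd (F r) i \<le> i \<and> snd (F r) i \<le> n"
      if "i \<in> {1..n}" for i
    proof -
      have "i \<in> {1..2*n}" "Suc (2*n) - i \<in> {1..2*n}" using that by auto
      from r1[OF this(1)] r1[OF this(2)] that show ?thesis by (auto simp: F_def)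
    qed
    moreover have "fst (F r) \<in> extensional {1..n}" "snd (F r) \<in> extensional {1..n}" by (simp_all add: F_def)
    ultimately have "F r \<in> ?D"
      by (auto simp: subdiag_def PiE_iff mem_Times_iff)
    moreover have "G (F r) = r"
    proof
      fix i show "G (F r) i = r i"
        using r1[of i] ext by (auto simp: F_def G_def extensional_def)
    qed
    moreover have "card (inversions {1..2*n} r) =
      ?x + (card (inversions {1..n} (fst (F r))) + card (inversions {1..n} (snd (F r))))"
    proof -
      have "r \<in> {1..2*n} \<rightarrow> {1..n}" using r1 by auto
      from card_inversions_halves[OF this] card_cross_inversions[of r n c] r
      show ?thesis by (simp add: F_def inv_restrict)
    qed
    ultimately show ?thesis by blast
  qed
  have G: "G (L, U) \<in> ?W \<and> F (G (L, U)) = (L, U)" if LU: "(L, U) \<in> ?D" for L U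
  proof -
    let ?r = "G (L, U)"
    have L: "L \<in> subdiag n c 0" and U: "U \<in> subdiag n (dual_content n c) 0" using LU by auto
    have L1: "L i \<in> {1..n} \<and> L i \<le> i" and U1: "U i \<in> {1..n} \<and> U i \<le> i" if "i \<in> {1..n}" for i
      using subdiag_pos[OF L c1(1) that] subdiag_pos[OF U c2 that] L U that
      by (auto simp: subdiag_def)
    have Lc: "card {i\<in>{1..n}. L i = l} = c l"
      and Uc: "card {i\<in>{1..n}. U i = l} = dual_content n c l" if "l \<in> {1..n}" for l
      using L U that by (auto simp: subdiag_def)
    have ext: "L \<in> extensional {1..n}" "U \<in> extensional {1..n}"
      using L U by (auto simp: subdiag_def PiE_iff)
    have r1: "?r i \<in> {1..n} \<and> ?r i \<le> i \<and> i \<le> ?r i + n" if "i \<in> {1..2*n}" for i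
    proof (cases "i \<le> n")
      case True
      then show ?thesis using that L1[of i] by (auto simp: G_def)
    next
      case False
      then have "Suc (2*n) - i \<in> {1..n}" using that by auto
      from U1[OF this] that False show ?thesis by (auto simp: G_def)
    qed
    have low: "card {i\<in>{1..n}. ?r i = j} = c j" if "j \<in> {1..n}" for j
    proof -
      have "{i\<in>{1..n}. ?r i = j} = {i\<in>{1..n}. L i = j}" by (auto simp: G_def)
      then show ?thesis using Lc[OF that] by simp
    qed
    have upp: "card {i\<in>{n<..2*n}. ?r i = j} = 2 - c j" if "j \<in> {1..n}" for j
    proof -
      have j: "Suc n - j \<in> {1..n}" using that by auto
      have "bij_betw (\<lambda>i. Suc (2*n) - i) {i\<in>{n<..2*n}. ?r i = j} {i\<in>{1..n}. U i = Suc n - j}"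
      proof (rule bij_betwI[where g = "\<lambda>i. Suc (2*n) - i"])
        show "(\<lambda>i. Suc (2*n) - i) \<in> {i\<in>{n<..2*n}. ?r i = j} \<rightarrow> {i\<in>{1..n}. U i = Suc n - j}"
        proof
          fix i assume "i \<in> {i\<in>{n<..2*n}. ?r i = j}"
          then show "Suc (2*n) - i \<in> {i\<in>{1..n}. U i = Suc n - j}"
            using U1[of "Suc (2*n) - i"] that by (auto simp: G_def)
        qed
        show "(\<lambda>i. Suc (2*n) - i) \<in> {i\<in>{1..n}. U i = Suc n - j} \<rightarrow> {i\<in>{n<..2*n}. ?r i = j}"
          using that by (auto simp: G_def)
      qed auto
      then show ?thesis
        using Uc[OF j] that by (simp add: bij_betw_same_card dual_content_def)
    qed
    have two: "card {i\<in>{1..2*n}. ?r i = j} = 2" if "j \<in> {1..n}" for j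
    proof -
      have "{i\<in>{1..2*n}. ?r i = j} = {i\<in>{1..n}. ?r i = j} \<union> {i\<in>{n<..2*n}. ?r i = j}" by auto
      moreover have "{i\<in>{1..n}. ?r i = j} \<inter> {i\<in>{n<..2*n}. ?r i = j} = {}" by auto
      ultimately have "card {i\<in>{1..2*n}. ?r i = j} = card {i\<in>{1..n}. ?r i = j} + card {i\<in>{n<..2*n}. ?r i = j}"
        by (simp add: card_Un_disjoint)
      then show ?thesis using low[OF that] upp[OF that] c1(3)[OF that] by simp
    qed
    have "?r \<in> extensional {1..2*n}" by (simp add: G_def)
    then have "?r \<in> dellac_words n"
      using r1 two by (auto simp: dellac_words_def PiE_iff simp del: atLeastAtMost_iff)
    moreover have "lower_content n ?r = c"
      using low c1(2) by (intro extensionalityI[of _ "{1..n}"]) (auto simp: lower_content_def)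
    moreover have "F ?r = (L, U)"
    proof -
      have "fst (F ?r) = L"
        using ext by (intro extensionalityI[of _ "{1..n}"]) (auto simp: F_def G_def)
      moreover have "snd (F ?r) = U"
      proof (rule extensionalityI[of _ "{1..n}"])
        fix i assume "i \<in> {1..n}"
        then show "snd (F ?r) i = U i" using U1[of i] by (auto simp: F_def G_def)
      qed (use ext in \<open>auto simp: F_def\<close>)
      ultimately show ?thesis by (metis prod.collapse)
    qed
    ultimately show ?thesis by blast
  qed
  have "(\<Sum>r\<in>?W. p ^ card (inversions {1..2*n} r)) =
      (\<Sum>(L, U)\<in>?D. p ^ (?x + (card (inversions {1..n} L) + card (inversions {1..n} U))))"
  proof (rule sum.reindex_bij_witness[of _ G F])
    fix r assume r: "r \<in> ?W"
    show "G (F r) = r" "F r \<in> ?D" using F[OF r] by blast+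
    show "(case F r of (L, U) \<Rightarrow> p ^ (?x + (card (inversions {1..n} L) + card (inversions {1..n} U))))
        = p ^ card (inversions {1..2*n} r)" using F[OF r] by (simp add: case_prod_beta)
  next
    fix LU assume "LU \<in> ?D"
    then show "F (G LU) = LU" "G LU \<in> ?W" using G[of "fst LU" "snd LU"] by simp_all
  qed
  also have "\<dots> = p ^ ?x * ((\<Sum>L\<in>subdiag n c 0. p ^ card (inversions {1..n} L)) *
     (\<Sum>U\<in>subdiag n (dual_content n c) 0. p ^ card (inversions {1..n} U)))"
    unfolding sum_product sum.cartesian_product
    by (simp add: power_add sum_distrib_left case_prod_beta)
  finally show ?thesis .
qed

text \<open>The factor of column \<open>j + 1\<close> when it has \<open>x\<close> dots in the lower rows and the columns up to \<open>j\<close>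
  have \<open>s\<close>. For \<open>s < j\<close> the level \<open>s - j\<close> is negative; the factor is then \<open>0\<close> as soon as \<open>x > 0\<close>,
  so such contents contribute nothing.\<close>

definition col_weight :: "'a::comm_ring_1 \<Rightarrow> nat \<Rightarrow> nat \<Rightarrow> nat \<Rightarrow> 'a" where
  "col_weight p j s x = p ^ (x * (2 * j - s)) * qbin p (s + x - j) x * qbin p (s + 1 - j) (2 - x)"

text \<open>The total \<open>s\<close> is left free because removing the last column changes it;
  configurations correspond to \<open>s = n\<close>.\<close>

definition content_sum :: "'a::comm_ring_1 \<Rightarrow> nat \<Rightarrow> nat \<Rightarrow> 'a" where
  "content_sum p n s = (\<Sum>c\<in>contents n s. \<Prod>j<n. col_weight p j (\<Sum>l\<in>{1..j}. c l) (c (Suc j)))"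

text \<open>Configurations are grouped by lower content, and the product formula for subdiagonal
  words is applied to both halves.\<close>

lemma sum_DC_content_sum: "(\<Sum>C\<in>DC n. p ^ inv_DC C) = content_sum p n n"
proof -
  have "(\<Sum>C\<in>DC n. p ^ inv_DC C) = (\<Sum>r\<in>dellac_words n. p ^ card (inversions {1..2*n} r))"
    by (rule sum_DC_dellac_words)
  also have "\<dots> = (\<Sum>c\<in>contents n n. \<Sum>r | r \<in> dellac_words n \<and> lower_content n r = c. p ^ card (inversions {1..2*n} r))"
    using lower_content_in_contents by (intro sum.group[symmetric]) auto
  also have "\<dots> = content_sum p n n"
    unfolding content_sum_def
  proof (rule sum.cong[OF refl])
    fix c assume c: "c \<in> contents n n"
    have "(\<Sum>U\<in>subdiag n (dual_content n c) 0. p ^ card (inversions {1..n} U)) =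
        (\<Prod>j<n. qbin p ((\<Sum>l\<in>{1..Suc j}. dual_content n c l) - j) (dual_content n c (Suc j)))"
      using sum_dual_content(1)[OF c, of 0] by (intro sum_subdiag) simp
    \<comment> \<open>The half-turn reversed the order of the columns; replacing \<open>j\<close> by
      \<open>n - Suc j\<close> restores it, so that the factors of both halves can be matched column
      by column.\<close>
    also have "\<dots> = (\<Prod>j<n. qbin p ((\<Sum>l\<in>{1..j}. c l) + 1 - j) (2 - c (Suc j)))"
    proof (rule prod.reindex_bij_witness[of _ "\<lambda>j. n - Suc j" "\<lambda>j. n - Suc j"])
      fix j assume j: "j \<in> {..<n}"
      then have *: "n - (n - Suc j) = Suc j" "Suc (n - Suc j) = n - j" by auto
      have "(\<Sum>l\<in>{1..n - Suc j}. c l) + 1 - (n - Suc j) = (\<Sum>l\<in>{1..Suc j}. dual_content n c l) - j"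
        using sum_dual_content[OF c, of "n - Suc j"] j unfolding * by simp
      moreover have "2 - c (Suc (n - Suc j)) = dual_content n c (Suc j)"
        using * by (simp add: dual_content_def)
      ultimately show "qbin p ((\<Sum>l\<in>{1..n - Suc j}. c l) + 1 - (n - Suc j)) (2 - c (Suc (n - Suc j))) =
        qbin p ((\<Sum>l\<in>{1..Suc j}. dual_content n c l) - j) (dual_content n c (Suc j))" by (simp only:)
    qed auto
    finally have U: "(\<Sum>U\<in>subdiag n (dual_content n c) 0. p ^ card (inversions {1..n} U)) =
        (\<Prod>j<n. qbin p ((\<Sum>l\<in>{1..j}. c l) + 1 - j) (2 - c (Suc j)))" .
    have L: "(\<Sum>L\<in>subdiag n c 0. p ^ card (inversions {1..n} L)) =
        (\<Prod>j<n. qbin p ((\<Sum>l\<in>{1..Suc j}. c l) - j) (c (Suc j)))"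
      using c by (intro sum_subdiag) (simp add: contents_def)
    show "(\<Sum>r | r \<in> dellac_words n \<and> lower_content n r = c. p ^ card (inversions {1..2*n} r)) =
        (\<Prod>j<n. col_weight p j (\<Sum>l\<in>{1..j}. c l) (c (Suc j)))"
      unfolding sum_dellac_words_content[OF c] L U col_weight_def prod.distrib
      by (simp add: power_sum mult.assoc)
  qed
  finally show ?thesis .
qed

section \<open>Comparison of the two recursions\<close>

lemma content_sum_0: "content_sum p 0 s = (if s = 0 then 1 else 0)"
  by (auto simp: content_sum_def contents_def)

lemma content_sum_eq_0: "2 * n < s \<Longrightarrow> content_sum p n s = 0"
proof -
  assume s: "2 * n < s"
  have "sum c {1..n} \<le> 2 * n" if "c \<in> {1..n} \<rightarrow>\<^sub>E {..2}" for c
    using sum_bounded_above[of "{1..n}" c 2] that by (auto simp: PiE_iff)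
  then have "c \<notin> contents n s" for c using s by (auto simp: contents_def not_le[symmetric])
  then have "contents n s = {}" by blast
  then show ?thesis by (simp add: content_sum_def)
qed

text \<open>The last column is split off, with \<open>x\<close> its number of lower dots; the
  condition \<open>x \<le> s\<close> keeps \<open>s - x\<close> from truncating.\<close>

lemma content_sum_Suc:
  "content_sum p (Suc n) s =
    (\<Sum>x | x \<le> 2 \<and> x \<le> s. content_sum p n (s - x) * col_weight p n (s - x) x)"
proof -
  let ?w = "\<lambda>n c. \<Prod>j<n. col_weight p j (\<Sum>l\<in>{1..j}. c l) (c (Suc j))"
  have "content_sum p (Suc n) s =
      (\<Sum>(x, c)\<in>Sigma {x. x \<le> 2 \<and> x \<le> s} (\<lambda>x. contents n (s - x)). ?w n c * col_weight p n (s - x) x)"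
    unfolding content_sum_def
  proof (rule sum.reindex_bij_witness[of _ "\<lambda>(x, c). c(Suc n := x)" "\<lambda>c. (c (Suc n), restrict c {1..n})"])
    fix c assume c: "c \<in> contents (Suc n) s"
    have ext: "c \<in> extensional {1..Suc n}" and c1: "\<And>i. i \<in> {1..Suc n} \<Longrightarrow> c i \<le> 2"
      and s: "(\<Sum>l\<in>{1..n}. c l) + c (Suc n) = s"
      using c by (auto simp: contents_def PiE_iff)
    show "(case (c (Suc n), restrict c {1..n}) of (x, c) \<Rightarrow> c(Suc n := x)) = c"
      using ext by (auto simp: extensional_def fun_eq_iff)
    show "(c (Suc n), restrict c {1..n}) \<in> Sigma {x. x \<le> 2 \<and> x \<le> s} (\<lambda>x. contents n (s - x))"
      using s c1 by (auto simp: contents_def PiE_iff)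
    have "?w n (restrict c {1..n}) = ?w n c" by (intro prod.cong) auto
    moreover have "s - c (Suc n) = (\<Sum>l\<in>{1..n}. c l)" using s by simp
    ultimately show "(case (c (Suc n), restrict c {1..n}) of (x, c) \<Rightarrow> ?w n c * col_weight p n (s - x) x) = ?w (Suc n) c"
      by simp
  next
    fix y assume "y \<in> Sigma {x. x \<le> 2 \<and> x \<le> s} (\<lambda>x. contents n (s - x))"
    then obtain x c where y: "y = (x, c)" "x \<le> 2" "x \<le> s" "c \<in> contents n (s - x)" by auto
    then have ext: "c \<in> extensional {1..n}" and c1: "\<And>i. i \<in> {1..n} \<Longrightarrow> c i \<le> 2"
      and s: "(\<Sum>l\<in>{1..n}. c l) = s - x"
      by (auto simp: contents_def PiE_iff)
    have "(\<Sum>l\<in>{1..n}. (c(Suc n := x)) l) = s - x" unfolding s[symmetric] by (intro sum.cong) auto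
    then have "sum (c(Suc n := x)) {1..Suc n} = s" using y by simp
    moreover have "c(Suc n := x) \<in> {1..Suc n} \<rightarrow>\<^sub>E {..2}"
      using c1 ext y(2) by (auto simp: PiE_iff extensional_def)
    ultimately show "(case y of (x, c) \<Rightarrow> c(Suc n := x)) \<in> contents (Suc n) s"
      using y by (simp add: contents_def)
    have "restrict (c(Suc n := x)) {1..n} = c"
      using ext by (intro extensionalityI[of _ "{1..n}"]) auto
    then show "((case y of (x, c) \<Rightarrow> c(Suc n := x)) (Suc n), restrict (case y of (x, c) \<Rightarrow> c(Suc n := x)) {1..n}) = y"
      using y by simp
  qed
  also have "\<dots> = (\<Sum>x | x \<le> 2 \<and> x \<le> s. \<Sum>c\<in>contents n (s - x). ?w n c * col_weight p n (s - x) x)"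
    by (simp add: sum.Sigma)
  finally show ?thesis by (simp add: content_sum_def sum_distrib_right)
qed

text \<open>At level 0 the last column either comes down from level 1 or stays at level 0.\<close>

lemma content_sum_excess_0:
  "content_sum p (Suc m) (Suc m) =
    qbin p 2 2 * content_sum p m (m + 1) + p ^ m * content_sum p m m"
proof -
  have "content_sum p (Suc m) (Suc m) = (\<Sum>x\<in>(if m = 0 then {0, 1} else {0, 1, 2}).
      content_sum p m (Suc m - x) * col_weight p m (Suc m - x) x)"
    unfolding content_sum_Suc by (intro sum.cong) auto
  also have "\<dots> = content_sum p m (Suc m) * col_weight p m (Suc m) 0 +
      content_sum p m m * col_weight p m m 1"
  proof (cases m)
    case (Suc k)
    \<comment> \<open>A last column with two lower dots would start from level -1; its factor
      vanishes.\<close>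
    have "qbin p 1 2 = 0" by (rule qbin_eq_0) simp
    then have "col_weight p m (Suc m - 2) 2 = 0" using Suc by (simp add: col_weight_def)
    then show ?thesis using Suc by simp
  qed simp
  finally show ?thesis
    by (simp add: col_weight_def mult.commute numeral_2_eq_2)
qed

text \<open>The terms belong to a last column with 0, 1 or 2 lower dots, coming from level
  \<open>k + 2\<close>, \<open>k + 1\<close> or \<open>k\<close>. The truncated exponents agree with
  those in \<open>col_weight\<close>.\<close>

lemma content_sum_excess_Suc:
  "content_sum p (Suc m) (Suc m + Suc k) =
    qbin p (k + 3) 2 * content_sum p m (m + (k + 2))
    + p ^ (m - Suc k) * (qbin p (k + 2) 1)\<^sup>2 * content_sum p m (m + Suc k)
    + p ^ (2 * (m - k)) * qbin p (k + 2) 2 * content_sum p m (m + k)"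
proof -
  have "content_sum p (Suc m) (Suc m + Suc k) = (\<Sum>x\<in>{0, 1, 2}.
      content_sum p m (Suc m + Suc k - x) * col_weight p m (Suc m + Suc k - x) x)"
    unfolding content_sum_Suc by (intro sum.cong) auto
  then show ?thesis
    by (simp add: col_weight_def power2_eq_square mult_ac numeral_3_eq_3 numeral_2_eq_2 add_ac)
qed

text \<open>Recursion on the last pair of steps of a path ending at height \<open>2 * k\<close>:
  up-up, the two mixed pairs together, and down-down from half-height \<open>Suc k\<close>. Labels
  are already summed.\<close>

fun history_sum :: "'a::field \<Rightarrow> nat \<Rightarrow> nat \<Rightarrow> 'a" where
  "history_sum q 0 k = (if k = 0 then 1 else 0)"
| "history_sum q (Suc m) k = (if k = 0 then 0 else history_sum q m (k - 1))
    + q ^ (2 * k) * (qbin (inverse q) (Suc k) 1)\<^sup>2 * history_sum q m k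
    + q ^ (4 * k + 1) * (qbin (inverse q) (k + 2) 2)\<^sup>2 * history_sum q m (Suc k)"

text \<open>The product, over the levels below \<open>k\<close>, of the normalised weights of
  level-raising columns; an up-up pair has weight 1 in a history.\<close>

fun gauge :: "'a::field \<Rightarrow> nat \<Rightarrow> 'a" where
  "gauge q 0 = 1"
| "gauge q (Suc k) = q ^ (3 * k + 1) * qbin (inverse q) (k + 2) 2 * gauge q k"

lemma power_mult_inverse_power:
  fixes q :: "'a::field"
  assumes "q \<noteq> 0" "a = b + c"
  shows "q ^ a * inverse q ^ b = q ^ c"
  using assms by (simp add: power_add power_inverse)

text \<open>A level-raising column of a configuration carries the weight that a history
  attaches to the matching level-lowering pair of steps; the factor \<open>gauge q k\<close> accounts for
  the \<open>k\<close> levels not yet lowered.\<close>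

lemma content_sum_eq_history_sum:
  fixes q :: "'a::field"
  assumes q: "q \<noteq> 0"
  shows "q ^ ((m choose 2) + m * k) * content_sum (inverse q) m (m + k) = gauge q k * history_sum q m k"
proof (induction m arbitrary: k)
  case 0
  then show ?case by (simp add: content_sum_0 numeral_2_eq_2)
next
  case (Suc m)
  let ?p = "inverse q"
  let ?A = "\<lambda>m k. content_sum ?p m (m + k)"
  have ch: "Suc m choose 2 = (m choose 2) + m" by (simp add: numeral_2_eq_2)
  \<comment> \<open>\<open>dd\<close>, \<open>level\<close> and \<open>uu\<close> match the
    recursions term by term: the level is lowered, kept or raised. In \<open>dd\<close> the second
    Gaussian factor comes from \<open>gauge q (Suc k)\<close>.\<close>
  have dd: "q ^ ((Suc m choose 2) + Suc m * k) * (qbin ?p (k + 2) 2 * ?A m (Suc k))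
      = gauge q k * (q ^ (4 * k + 1) * (qbin ?p (k + 2) 2)\<^sup>2 * history_sum q m (Suc k))" for k
  proof -
    have "q ^ ((Suc m choose 2) + Suc m * k) = q ^ k * q ^ ((m choose 2) + m * Suc k)"
      unfolding ch by (simp add: power_add[symmetric] algebra_simps)
    then have "q ^ ((Suc m choose 2) + Suc m * k) * (qbin ?p (k + 2) 2 * ?A m (Suc k))
        = q ^ k * qbin ?p (k + 2) 2 * (q ^ ((m choose 2) + m * Suc k) * ?A m (Suc k))"
      by (simp only: mult_ac)
    also have "\<dots> = q ^ k * q ^ (3 * k + 1) * gauge q k * (qbin ?p (k + 2) 2)\<^sup>2 * history_sum q m (Suc k)"
      unfolding Suc.IH by (simp add: power2_eq_square mult_ac)
    also have "q ^ k * q ^ (3 * k + 1) = q ^ (4 * k + 1)" by (simp add: power_add[symmetric])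
    finally show ?thesis by (simp add: mult_ac)
  qed
  have level: "q ^ ((Suc m choose 2) + Suc m * k) * (?p ^ (m - k) * (qbin ?p (Suc k) 1)\<^sup>2 * ?A m k)
      = gauge q k * (q ^ (2 * k) * (qbin ?p (Suc k) 1)\<^sup>2 * history_sum q m k)" for k
  proof (cases "k \<le> m")
    case True
    have "q ^ ((Suc m choose 2) + Suc m * k) * ?p ^ (m - k) = q ^ (2 * k + ((m choose 2) + m * k))"
      by (rule power_mult_inverse_power[OF q]) (use True in \<open>simp add: ch\<close>)
    then have "q ^ ((Suc m choose 2) + Suc m * k) * (?p ^ (m - k) * (qbin ?p (Suc k) 1)\<^sup>2 * ?A m k)
        = q ^ (2 * k) * (qbin ?p (Suc k) 1)\<^sup>2 * (q ^ ((m choose 2) + m * k) * ?A m k)"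
      by (simp only: mult.assoc[symmetric]) (simp only: power_add mult_ac)
    then show ?thesis unfolding Suc.IH by (simp only: mult_ac)
  next
    case False
    \<comment> \<open>For \<open>k > m\<close> the exponent \<open>m - k\<close> truncates, but
      \<open>m\<close> columns cannot hold \<open>m + k\<close> lower dots; by induction the right
      side vanishes as well.\<close>
    then have A: "?A m k = 0" by (intro content_sum_eq_0) simp
    then have "gauge q k * history_sum q m k = 0" using Suc.IH[of k] by simp
    then show ?thesis using A by auto
  qed
  show ?case
  proof (cases k)
    case 0
    show ?thesis
      using dd[of 0] level[of 0] unfolding 0
      by (simp add: content_sum_excess_0[of ?p m] distrib_left numeral_2_eq_2 add.commute)
  next
    case (Suc i)
    have uu: "q ^ ((Suc m choose 2) + Suc m * Suc i) * (?p ^ (2 * (m - i)) * qbin ?p (i + 2) 2 * ?A m i)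
        = gauge q (Suc i) * history_sum q m i"
    proof (cases "i \<le> m")
      case True
      have "q ^ ((Suc m choose 2) + Suc m * Suc i) * ?p ^ (2 * (m - i)) = q ^ (3 * i + 1 + ((m choose 2) + m * i))"
        by (rule power_mult_inverse_power[OF q]) (use True in \<open>simp add: ch\<close>)
      then have "q ^ ((Suc m choose 2) + Suc m * Suc i) * (?p ^ (2 * (m - i)) * qbin ?p (i + 2) 2 * ?A m i)
          = q ^ (3 * i + 1) * qbin ?p (i + 2) 2 * (q ^ ((m choose 2) + m * i) * ?A m i)"
        by (simp only: mult.assoc[symmetric]) (simp only: power_add mult_ac)
      then show ?thesis unfolding Suc.IH by (simp add: mult_ac)
    next
      case False
      then have A: "?A m i = 0" by (intro content_sum_eq_0) simp
      then have "gauge q i * history_sum q m i = 0" using Suc.IH[of i] by simp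
      then show ?thesis using A by auto
    qed
    have "i + 3 = Suc i + 2" "i + 2 = Suc (Suc i)" by auto
    then show ?thesis
      using dd[of "Suc i"] level[of "Suc i"] uu unfolding Suc content_sum_excess_Suc history_sum.simps
      by (simp only: distrib_left) (simp add: add_ac)
  qed
qed

section \<open>Labels of a fixed Dyck path\<close>

text \<open>The rules for pairs of steps are rearranged by the position \<open>m\<close> of a single
  down step, so that labels can be chosen independently. Over \<open>nat\<close>, the bound
  \<open>k - 1\<close> is written as a strict inequality.\<close>

definition step_labels :: "(nat \<times> nat) list \<Rightarrow> nat \<Rightarrow> (nat \<times> nat) set" where
  "step_labels \<gamma> m = (let j = (m + 1) div 2; k = snd (\<gamma> ! (2*j - 2)) div 2 in
     if m = 2*j - 1 then
       (if up_step \<gamma> (2*j) then {(a, b). b < a \<and> a \<le> k} else {(a, b). b \<le> a \<and> a < k})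
     else (if up_step \<gamma> (2*j - 1) then {(a, b). a \<le> b \<and> b \<le> k} else {(a, b). a \<le> b \<and> b < k}))"

definition step_exponent :: "(nat \<times> nat) list \<Rightarrow> nat \<Rightarrow> nat \<times> nat \<Rightarrow> int" where
  "step_exponent \<gamma> m x = (let j = (m + 1) div 2; k = half_height \<gamma> j in
     2*k - int (fst x) - int (snd x) -
       (if m = 2*j - 1 then (if up_step \<gamma> (2*j) then 0 else 1)
        else (if up_step \<gamma> (2*j - 1) then 0 else 2)))"

lemma finite_step_labels [simp]: "finite (step_labels \<gamma> m)"
proof -
  let ?k = "snd (\<gamma> ! (2*((m + 1) div 2) - 2)) div 2"
  show ?thesis
    by (rule finite_subset[of _ "{..?k} \<times> {..?k}"]) (auto simp: step_labels_def Let_def)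
qed

lemma step_weight_eq: "step_weight \<gamma> \<xi> i = fls_X powi step_exponent \<gamma> (down_pos \<gamma> i) (\<xi> ! (i - 1))"
proof -
  define m where "m = down_pos \<gamma> i"
  have "m = 2 * ((m + 1) div 2) - 1 \<or> m = 2 * ((m + 1) div 2)" by presburger
  then show ?thesis
    unfolding step_weight_def step_exponent_def Let_def m_def[symmetric] n1_def n2_def
    by (auto simp: algebra_simps)
qed

lemma step_labels_first:
  assumes "j \<ge> 1"
  shows "step_labels \<gamma> (2*j - 1) = (if up_step \<gamma> (2*j) then {(a, b). b < a \<and> a \<le> snd (\<gamma> ! (2*j - 2)) div 2}
    else {(a, b). b \<le> a \<and> a < snd (\<gamma> ! (2*j - 2)) div 2})"
proof -
  have "(2*j - 1 + 1) div 2 = j" using assms by auto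
  then show ?thesis unfolding step_labels_def Let_def by simp
qed

lemma step_labels_second:
  assumes "j \<ge> 1"
  shows "step_labels \<gamma> (2*j) = (if up_step \<gamma> (2*j - 1) then {(a, b). a \<le> b \<and> b \<le> snd (\<gamma> ! (2*j - 2)) div 2}
    else {(a, b). a \<le> b \<and> b < snd (\<gamma> ! (2*j - 2)) div 2})"
proof -
  have "(2*j + 1) div 2 = j" "2*j \<noteq> 2*j - 1" using assms by auto
  then show ?thesis unfolding step_labels_def Let_def by simp
qed

lemma step_exponent_first:
  assumes "j \<ge> 1"
  shows "step_exponent \<gamma> (2*j - 1) x =
    2 * half_height \<gamma> j - int (fst x) - int (snd x) - (if up_step \<gamma> (2*j) then 0 else 1)"
proof -
  have "(2*j - 1 + 1) div 2 = j" using assms by auto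
  then show ?thesis unfolding step_exponent_def Let_def by simp
qed

lemma step_exponent_second:
  assumes "j \<ge> 1"
  shows "step_exponent \<gamma> (2*j) x =
    2 * half_height \<gamma> j - int (fst x) - int (snd x) - (if up_step \<gamma> (2*j - 1) then 0 else 2)"
proof -
  have "(2*j + 1) div 2 = j" "2*j \<noteq> 2*j - 1" using assms by auto
  then show ?thesis unfolding step_exponent_def Let_def by simp
qed

lemma not_up_and_down: "up_step \<gamma> m \<Longrightarrow> \<not> down_step \<gamma> m"
  by (auto simp: up_step_def down_step_def)

text \<open>No entry fits strictly between a number and its successor. Applied to the list of down
  steps, this gives adjacent down steps consecutive indices.\<close>

lemma sorted_wrt_less_consecutive:
  fixes xs :: "nat list"
  assumes xs: "sorted_wrt (<) xs" and a: "a < length xs" and mem: "Suc (xs ! a) \<in> set xs"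
  shows "Suc a < length xs \<and> xs ! Suc a = Suc (xs ! a)"
proof -
  obtain b where b: "b < length xs" "xs ! b = Suc (xs ! a)" using mem by (auto simp: in_set_conv_nth)
  have lt: "xs ! i < xs ! j" if "i < j" "j < length xs" for i j
    using sorted_wrt_nth_less[OF xs] that by blast
  have "\<not> b \<le> a" using lt[of b a] a b by (cases "b = a") auto
  moreover have "\<not> Suc a < b" using lt[of a "Suc a"] lt[of "Suc a" b] b by auto
  ultimately have "b = Suc a" by simp
  then show ?thesis using b by simp
qed

context
  fixes n :: nat and \<gamma> :: "(nat \<times> nat) list"
  assumes dyck: "dyck_path n \<gamma>"
begin

lemma dyck_step: "t \<in> {1..2*n} \<Longrightarrow> up_step \<gamma> t \<or> down_step \<gamma> t"
  using dyck by (simp add: dyck_path_def)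

text \<open>Each step changes the height by one, so the height is the number of steps minus twice
  the number of down steps. At \<open>t = 2*n\<close> this yields exactly \<open>n\<close> down
  steps.\<close>

lemma dyck_height:
  "t \<le> 2*n \<Longrightarrow> snd (\<gamma> ! t) + 2 * card {m\<in>{1..t}. down_step \<gamma> m} = t"
proof (induction t)
  case 0
  then show ?case using dyck by (simp add: dyck_path_def)
next
  case (Suc t)
  have split: "{m\<in>{1..Suc t}. down_step \<gamma> m} =
      (if down_step \<gamma> (Suc t) then insert (Suc t) {m\<in>{1..t}. down_step \<gamma> m} else {m\<in>{1..t}. down_step \<gamma> m})"
    by (auto simp: le_Suc_eq)
  have "up_step \<gamma> (Suc t) \<or> down_step \<gamma> (Suc t)" using dyck_step[of "Suc t"] Suc.prems by simp
  then show ?case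
  proof
    assume u: "up_step \<gamma> (Suc t)"
    then have "\<not> down_step \<gamma> (Suc t)" by (rule not_up_and_down)
    then show ?case using Suc u unfolding split by (simp add: up_step_def)
  next
    assume d: "down_step \<gamma> (Suc t)"
    then show ?case using Suc unfolding split by (simp add: down_step_def)
  qed
qed

lemma down_list:
  defines "ds \<equiv> filter (down_step \<gamma>) [1..<length \<gamma>]"
  shows "sorted_wrt (<) ds" "distinct ds" "length ds = n" "set ds = {m\<in>{1..2*n}. down_step \<gamma> m}"
proof -
  show "sorted_wrt (<) ds" unfolding ds_def by (rule sorted_wrt_filter) simp
  show d: "distinct ds" unfolding ds_def by simp
  have len: "length \<gamma> = 2*n + 1" using dyck by (simp add: dyck_path_def)
  show s: "set ds = {m\<in>{1..2*n}. down_step \<gamma> m}" unfolding ds_def len by auto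
  have "snd (\<gamma> ! (2*n)) = 0" using dyck by (simp add: dyck_path_def)
  then have "card (set ds) = n" using dyck_height[of "2*n"] s by simp
  then show "length ds = n" using d distinct_card by metis
qed

lemma bij_down_pos: "bij_betw (down_pos \<gamma>) {1..n} {m\<in>{1..2*n}. down_step \<gamma> m}"
proof -
  let ?ds = "filter (down_step \<gamma>) [1..<length \<gamma>]"
  have "bij_betw (\<lambda>i. i - 1) {1..n} {..<n}"
    by (rule bij_betwI[where g = Suc]) auto
  moreover have "bij_betw (\<lambda>i. ?ds ! i) {..<n} {m\<in>{1..2*n}. down_step \<gamma> m}"
    using bij_betw_nth[OF down_list(2)] down_list(3,4) by simp
  ultimately have "bij_betw ((\<lambda>i. ?ds ! i) \<circ> (\<lambda>i. i - 1)) {1..n} {m\<in>{1..2*n}. down_step \<gamma> m}"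
    by (rule bij_betw_trans)
  moreover have "(\<lambda>i. ?ds ! i) \<circ> (\<lambda>i. i - 1) = down_pos \<gamma>" by (auto simp: down_pos_def)
  ultimately show ?thesis by simp
qed

lemma down_pos_Suc:
  assumes i: "i \<in> {1..n}" and d: "down_step \<gamma> (Suc (down_pos \<gamma> i))" "Suc (down_pos \<gamma> i) \<le> 2*n"
  shows "i < n \<and> down_pos \<gamma> (i + 1) = Suc (down_pos \<gamma> i)"
proof -
  let ?ds = "filter (down_step \<gamma>) [1..<length \<gamma>]"
  have "Suc (?ds ! (i - 1)) \<in> set ?ds"
    unfolding down_list(4) using d by (simp add: down_pos_def)
  moreover have "i - 1 < length ?ds" unfolding down_list(3) using i by auto
  ultimately have "Suc (i - 1) < length ?ds \<and> ?ds ! Suc (i - 1) = Suc (?ds ! (i - 1))"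
    by (intro sorted_wrt_less_consecutive[OF down_list(1)])
  then show ?thesis unfolding down_list(3) using i by (simp add: down_pos_def)
qed

lemma down_pos_mem: "i \<in> {1..n} \<Longrightarrow> down_pos \<gamma> i \<in> {1..2*n} \<and> down_step \<gamma> (down_pos \<gamma> i)"
  using bij_betwE[OF bij_down_pos] by blast

text \<open>Every down step lies in one pair of steps and is in one of four situations there; in
  each, the rule for the pair restricts its own label only.\<close>

lemma DH_iff:
  "(\<gamma>, \<xi>) \<in> DH n \<longleftrightarrow> length \<xi> = n \<and> (\<forall>i\<in>{1..n}. \<xi> ! (i - 1) \<in> step_labels \<gamma> (down_pos \<gamma> i))"
proof -
  have hh: "half_height \<gamma> j = int (snd (\<gamma> ! (2*j - 2)) div 2)" for j
    by (simp add: half_height_def zdiv_int)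
  let ?ok = "\<forall>j\<in>{1..n}. let k = half_height \<gamma> j in
        (\<forall>i\<in>{1..n}. down_pos \<gamma> i = 2*j - 1 \<and> up_step \<gamma> (2*j) \<longrightarrow>
           k \<ge> n1 \<xi> i \<and> n1 \<xi> i > n2 \<xi> i \<and> n2 \<xi> i \<ge> 0) \<and>
        (\<forall>i\<in>{1..n}. up_step \<gamma> (2*j - 1) \<and> down_pos \<gamma> i = 2*j \<longrightarrow>
           0 \<le> n1 \<xi> i \<and> n1 \<xi> i \<le> n2 \<xi> i \<and> n2 \<xi> i \<le> k) \<and>
        (\<forall>i\<in>{1..<n}. down_pos \<gamma> i = 2*j - 1 \<and> down_pos \<gamma> (i + 1) = 2*j \<longrightarrow>
           k - 1 \<ge> n1 \<xi> i \<and> n1 \<xi> i \<ge> n2 \<xi> i \<and> n2 \<xi> i \<ge> 0 \<and>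
           0 \<le> n1 \<xi> (i + 1) \<and> n1 \<xi> (i + 1) \<le> n2 \<xi> (i + 1) \<and> n2 \<xi> (i + 1) \<le> k - 1)"
  have "?ok \<longleftrightarrow> (\<forall>i\<in>{1..n}. \<xi> ! (i - 1) \<in> step_labels \<gamma> (down_pos \<gamma> i))" (is "_ \<longleftrightarrow> ?R")
  proof
    assume ok: ?ok
    show ?R
    proof
      fix i assume i: "i \<in> {1..n}"
      define m where "m = down_pos \<gamma> i"
      define j where "j = (m + 1) div 2"
      have m: "m \<in> {1..2*n}" "down_step \<gamma> m" using down_pos_mem[OF i] by (auto simp: m_def)
      have j: "j \<in> {1..n}" using m by (auto simp: j_def)
      then have j1: "1 \<le> j" by simp
      note okj = bspec[OF ok j, unfolded Let_def]
      note ok1 = conjunct1[OF okj] and ok2 = conjunct1[OF conjunct2[OF okj]]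
        and ok3 = conjunct2[OF conjunct2[OF okj]]
      have "m = 2*j - 1 \<or> m = 2*j" unfolding j_def by presburger
      moreover have 2: "2*j - 1 \<in> {1..2*n}" using j by auto
      ultimately consider (du) "m = 2*j - 1" "up_step \<gamma> (2*j)" | (d1) "m = 2*j - 1" "down_step \<gamma> (2*j)"
        | (ud) "m = 2*j" "up_step \<gamma> (2*j - 1)" | (d2) "m = 2*j" "down_step \<gamma> (2*j - 1)"
        using dyck_step[of "2*j"] dyck_step[of "2*j - 1", OF 2] j by auto
      then have "\<xi> ! (i - 1) \<in> step_labels \<gamma> m"
      proof cases
        case du
        then show ?thesis using bspec[OF ok1 i] unfolding m_def[symmetric] du(1) step_labels_first[OF j1]
          by (auto simp: n1_def n2_def hh split: prod.splits)
      next
        case d1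
        have "\<not> up_step \<gamma> (2*j)" using d1 not_up_and_down by blast
        moreover have "Suc m = 2*j" using d1 j by auto
        moreover from this have "i < n \<and> down_pos \<gamma> (i + 1) = 2*j"
          using down_pos_Suc[OF i] d1 j by (simp add: m_def[symmetric])
        ultimately show ?thesis using bspec[OF ok3, of i] d1(2) i
          unfolding m_def[symmetric] d1(1) step_labels_first[OF j1]
          by (auto simp: n1_def n2_def hh split: prod.splits)
      next
        case ud
        then show ?thesis using bspec[OF ok2 i] unfolding m_def[symmetric] ud(1) step_labels_second[OF j1]
          by (auto simp: n1_def n2_def hh split: prod.splits)
      next
        case d2
        \<comment> \<open>The rule for two down steps is indexed by the first of them, so the index
          \<open>i'\<close> of the preceding down step is recovered, with
          \<open>i = i' + 1\<close>.\<close>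
        have "2*j - 1 \<in> {m\<in>{1..2*n}. down_step \<gamma> m}" using d2 j by auto
        then obtain i' where i': "i' \<in> {1..n}" "down_pos \<gamma> i' = 2*j - 1"
          using bij_betw_imp_surj_on[OF bij_down_pos] by (metis (no_types, lifting) imageE)
        have "i' < n \<and> down_pos \<gamma> (i' + 1) = m"
          using down_pos_Suc[OF i'(1)] i' d2 j m by simp
        moreover from this have "i = i' + 1"
          using inj_onD[OF bij_betw_imp_inj_on[OF bij_down_pos], of i "i' + 1"] i i' by (simp add: m_def)
        moreover have "\<not> up_step \<gamma> (2*j - 1)" using d2 not_up_and_down by blast
        ultimately show ?thesis using bspec[OF ok3, of i'] i'
          unfolding d2(1) step_labels_second[OF j1]
          by (auto simp: n1_def n2_def hh split: prod.splits)
      qed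
      then show "\<xi> ! (i - 1) \<in> step_labels \<gamma> (down_pos \<gamma> i)" by (simp add: m_def)
    qed
  next
    assume R: ?R
    show ?ok
      unfolding Let_def
    proof (intro ballI conjI impI)
      fix j i assume j: "j \<in> {1..n}" and i: "i \<in> {1..n}" and a: "down_pos \<gamma> i = 2*j - 1 \<and> up_step \<gamma> (2*j)"
      have j1: "1 \<le> j" using j by simp
      show "n1 \<xi> i \<le> half_height \<gamma> j" "n2 \<xi> i < n1 \<xi> i" "0 \<le> n2 \<xi> i"
        using bspec[OF R i] a by (auto simp: step_labels_first[OF j1, simplified] step_labels_second[OF j1, simplified] n1_def n2_def hh split: prod.splits)
    next
      fix j i assume j: "j \<in> {1..n}" and i: "i \<in> {1..n}" and a: "up_step \<gamma> (2*j - 1) \<and> down_pos \<gamma> i = 2*j"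
      have j1: "1 \<le> j" using j by simp
      show "n1 \<xi> i \<le> n2 \<xi> i" "n2 \<xi> i \<le> half_height \<gamma> j" "0 \<le> n1 \<xi> i"
        using bspec[OF R i] a by (auto simp: step_labels_first[OF j1, simplified] step_labels_second[OF j1, simplified] n1_def n2_def hh split: prod.splits)
    next
      fix j i assume j: "j \<in> {1..n}" and i: "i \<in> {1..<n}"
        and a: "down_pos \<gamma> i = 2*j - 1 \<and> down_pos \<gamma> (i + 1) = 2*j"
      have i': "i \<in> {1..n}" "i + 1 \<in> {1..n}" using i by auto
      have "\<not> up_step \<gamma> (2*j - 1)" "\<not> up_step \<gamma> (2*j)"
        using down_pos_mem[OF i'(1)] down_pos_mem[OF i'(2)] a not_up_and_down by auto
      moreover have j1: "1 \<le> j" using j by simp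
      ultimately show "n1 \<xi> i \<le> half_height \<gamma> j - 1" "n2 \<xi> i \<le> n1 \<xi> i" "0 \<le> n2 \<xi> i"
          "0 \<le> n1 \<xi> (i + 1)" "n1 \<xi> (i + 1) \<le> n2 \<xi> (i + 1)" "n2 \<xi> (i + 1) \<le> half_height \<gamma> j - 1"
        using bspec[OF R i'(1)] bspec[OF R i'(2)] a
        by (auto simp: step_labels_first[OF j1, simplified] step_labels_second[OF j1, simplified] n1_def n2_def hh split: prod.splits)
    qed
  qed
  then show ?thesis using dyck unfolding DH_def by simp
qed

end

section \<open>Summation over Dyck paths\<close>

text \<open>The value 1 at up steps lets products run over all steps of a path.\<close>

definition label_sum :: "'a::field \<Rightarrow> (nat \<times> nat) list \<Rightarrow> nat \<Rightarrow> 'a" where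
  "label_sum q \<gamma> t = (if down_step \<gamma> t then \<Sum>x\<in>step_labels \<gamma> t. q powi step_exponent \<gamma> t x else 1)"

lemma bij_betw_DH_labels:
  assumes dyck: "dyck_path n \<gamma>"
  shows "bij_betw (\<lambda>\<xi>. \<lambda>i\<in>{1..n}. \<xi> ! (i - 1)) {\<xi>. (\<gamma>, \<xi>) \<in> DH n}
    (PiE {1..n} (\<lambda>i. step_labels \<gamma> (down_pos \<gamma> i)))"
proof (rule bij_betwI[where g = "\<lambda>g. map (\<lambda>i. g (Suc i)) [0..<n]"])
  show "(\<lambda>\<xi>. \<lambda>i\<in>{1..n}. \<xi> ! (i - 1)) \<in> {\<xi>. (\<gamma>, \<xi>) \<in> DH n} \<rightarrow>
      PiE {1..n} (\<lambda>i. step_labels \<gamma> (down_pos \<gamma> i))"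
    by (auto simp: DH_iff[OF dyck])
  show "(\<lambda>g. map (\<lambda>i. g (Suc i)) [0..<n]) \<in> PiE {1..n} (\<lambda>i. step_labels \<gamma> (down_pos \<gamma> i)) \<rightarrow>
      {\<xi>. (\<gamma>, \<xi>) \<in> DH n}"
    by (auto simp: DH_iff[OF dyck] PiE_iff)
  show "map (\<lambda>i. (\<lambda>i\<in>{1..n}. \<xi> ! (i - 1)) (Suc i)) [0..<n] = \<xi>" if "\<xi> \<in> {\<xi>. (\<gamma>, \<xi>) \<in> DH n}" for \<xi>
    using that by (intro nth_equalityI) (auto simp: DH_iff[OF dyck])
  show "(\<lambda>i\<in>{1..n}. map (\<lambda>i. g (Suc i)) [0..<n] ! (i - 1)) = g"
    if "g \<in> PiE {1..n} (\<lambda>i. step_labels \<gamma> (down_pos \<gamma> i))" for g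
    using that by (intro extensionalityI[of _ "{1..n}"]) (auto simp: PiE_iff)
qed

text \<open>The labels of different down steps are independent, so the sum of products is a product
  of sums, which is then indexed by position instead of by \<open>i\<close>.\<close>

lemma sum_DH_labels:
  assumes dyck: "dyck_path n \<gamma>"
  shows "(\<Sum>\<xi> | (\<gamma>, \<xi>) \<in> DH n. \<Prod>i=1..n. q powi step_exponent \<gamma> (down_pos \<gamma> i) (\<xi> ! (i - 1)))
    = (\<Prod>t\<in>{1..2*n}. label_sum q \<gamma> t)"
proof -
  let ?d = "down_pos \<gamma>"
  have "(\<Sum>\<xi> | (\<gamma>, \<xi>) \<in> DH n. \<Prod>i=1..n. q powi step_exponent \<gamma> (?d i) (\<xi> ! (i - 1)))
      = (\<Sum>\<xi> | (\<gamma>, \<xi>) \<in> DH n. (\<lambda>g. \<Prod>i=1..n. q powi step_exponent \<gamma> (?d i) (g i)) (\<lambda>i\<in>{1..n}. \<xi> ! (i - 1)))"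
    by simp
  also have "\<dots> = (\<Sum>g\<in>PiE {1..n} (\<lambda>i. step_labels \<gamma> (?d i)). \<Prod>i=1..n. q powi step_exponent \<gamma> (?d i) (g i))"
    by (rule sum.reindex_bij_betw[OF bij_betw_DH_labels[OF dyck]])
  also have "\<dots> = (\<Prod>i=1..n. \<Sum>x\<in>step_labels \<gamma> (?d i). q powi step_exponent \<gamma> (?d i) x)"
    by (rule prod_sum_PiE[symmetric]) auto
  also have "\<dots> = (\<Prod>t | t \<in> {1..2*n} \<and> down_step \<gamma> t. \<Sum>x\<in>step_labels \<gamma> t. q powi step_exponent \<gamma> t x)"
    by (rule prod.reindex_bij_betw[OF bij_down_pos[OF dyck]])
  also have "\<dots> = (\<Prod>t\<in>{1..2*n}. label_sum q \<gamma> t)"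
    unfolding label_sum_def by (rule prod.inter_filter) simp
  finally show ?thesis .
qed

section \<open>Building paths two steps at a time\<close>

definition paths :: "nat \<Rightarrow> nat \<Rightarrow> (nat \<times> nat) list set" where
  "paths m k = {\<gamma>. length \<gamma> = 2*m + 1 \<and> \<gamma> ! 0 = (0, 0) \<and> \<gamma> ! (2*m) = (2*m, 2*k) \<and>
     (\<forall>t\<in>{1..2*m}. up_step \<gamma> t \<or> down_step \<gamma> t)}"

lemma dyck_path_iff_paths: "dyck_path n \<gamma> \<longleftrightarrow> \<gamma> \<in> paths n 0"
  by (simp add: dyck_path_def paths_def)

lemma up_step_append: "t < length \<gamma> \<Longrightarrow> up_step (\<gamma> @ \<delta>) t = up_step \<gamma> t"
  by (auto simp: up_step_def nth_append)

lemma down_step_append: "t < length \<gamma> \<Longrightarrow> down_step (\<gamma> @ \<delta>) t = down_step \<gamma> t"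
  by (auto simp: down_step_def nth_append)

text \<open>The labels of a step depend only on the points of its own pair, and a pair containing
  \<open>t \<le> 2*m\<close> ends by point \<open>2*m\<close>.\<close>

lemma label_sum_append:
  assumes len: "length \<gamma> = 2*m + 1" and t: "t \<in> {1..2*m}"
  shows "label_sum q (\<gamma> @ \<delta>) t = label_sum q \<gamma> t"
proof -
  have "(t + 1) div 2 \<le> m" using t by auto
  then have "t < 2*m + 1" "2 * ((t + 1) div 2) < 2*m + 1" "2 * ((t + 1) div 2) - 1 < 2*m + 1"
    "2 * ((t + 1) div 2) - 2 < 2*m + 1" using t by auto
  then show ?thesis
    unfolding label_sum_def step_labels_def step_exponent_def half_height_def Let_def
    using len by (simp add: up_step_append down_step_append nth_append)
qed

definition extend :: "nat \<Rightarrow> nat \<Rightarrow> nat \<Rightarrow> (nat \<times> nat) list \<Rightarrow> (nat \<times> nat) list" where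
  "extend m y z \<gamma> = \<gamma> @ [(2*m + 1, y), (2*m + 2, z)]"

lemma inj_extend: "inj_on (extend m y z) A"
  by (auto simp: inj_on_def extend_def)

lemma steps_extend:
  assumes "\<gamma> \<in> paths m k"
  shows "up_step (extend m y z \<gamma>) (2 * Suc m - 1) \<longleftrightarrow> y = 2*k + 1"
    and "down_step (extend m y z \<gamma>) (2 * Suc m - 1) \<longleftrightarrow> y + 1 = 2*k"
    and "up_step (extend m y z \<gamma>) (2 * Suc m) \<longleftrightarrow> z = y + 1"
    and "down_step (extend m y z \<gamma>) (2 * Suc m) \<longleftrightarrow> z + 1 = y"
    and "snd (extend m y z \<gamma> ! (2 * Suc m - 2)) = 2*k"
  using assms by (auto simp: up_step_def down_step_def extend_def paths_def nth_append)

lemma extend_in_paths: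
  assumes \<gamma>: "\<gamma> \<in> paths m k'" and y: "y = 2*k' + 1 \<or> y + 1 = 2*k'" and z: "2*k = y + 1 \<or> 2*k + 1 = y"
  shows "extend m y (2*k) \<gamma> \<in> paths (Suc m) k"
proof -
  let ?\<gamma> = "extend m y (2*k) \<gamma>"
  have len: "length \<gamma> = 2*m + 1" using \<gamma> by (simp add: paths_def)
  have "up_step ?\<gamma> t \<or> down_step ?\<gamma> t" if "t \<in> {1..2 * Suc m}" for t
  proof -
    have "t \<in> {1..2*m} \<or> t = 2 * Suc m - 1 \<or> t = 2 * Suc m" using that unfolding atLeastAtMost_iff by arith
    then consider "t \<in> {1..2*m}" | "t = 2 * Suc m - 1" | "t = 2 * Suc m" by blast
    then show ?thesis
    proof cases
      case 1
      then show ?thesis using \<gamma> len by (auto simp: extend_def up_step_append down_step_append paths_def)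
    qed (use steps_extend[OF \<gamma>, of y "2*k"] y z in auto)
  qed
  then show ?thesis using \<gamma> by (simp add: paths_def extend_def nth_append)
qed

text \<open>Cutting off the last two points leaves a path whose final height is even, since two
  steps preserve parity.\<close>

lemma paths_extend_cases:
  assumes \<gamma>: "\<gamma> \<in> paths (Suc m) k"
  obtains \<delta> y k' where "\<delta> \<in> paths m k'" "\<gamma> = extend m y (2*k) \<delta>"
    "y = 2*k' + 1 \<or> y + 1 = 2*k'" "2*k = y + 1 \<or> 2*k + 1 = y"
proof -
  define \<delta> where "\<delta> = take (2*m + 1) \<gamma>"
  have len: "length \<gamma> = 2*m + 3" and start: "\<gamma> ! 0 = (0, 0)" and fin: "\<gamma> ! (2*m + 2) = (2*m + 2, 2*k)"
    and steps: "\<And>t. t \<in> {1..2*m + 2} \<Longrightarrow> up_step \<gamma> t \<or> down_step \<gamma> t"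
    using \<gamma> by (auto simp: paths_def)
  have lend: "length \<delta> = 2*m + 1" using len by (simp add: \<delta>_def)
  obtain a y where ay: "\<gamma> ! (2*m + 1) = (a, y)" by (cases "\<gamma> ! (2*m + 1)")
  obtain b h where bh: "\<gamma> ! (2*m) = (b, h)" by (cases "\<gamma> ! (2*m)")
  have s2: "a = 2*m + 1 \<and> (2*k = y + 1 \<or> 2*k + 1 = y)"
    using steps[of "2*m + 2"] fin ay by (auto simp: up_step_def down_step_def)
  have s1: "b = 2*m \<and> (y = h + 1 \<or> y + 1 = h)"
    using steps[of "2*m + 1"] s2 ay bh by (auto simp: up_step_def down_step_def)
  have "\<gamma> = \<delta> @ [\<gamma> ! (2*m + 1), \<gamma> ! (2*m + 2)]"
  proof (rule nth_equalityI)
    fix i assume "i < length \<gamma>"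
    then consider "i < 2*m + 1" | "i = 2*m + 1" | "i = 2*m + 2" using len by linarith
    then show "\<gamma> ! i = (\<delta> @ [\<gamma> ! (2*m + 1), \<gamma> ! (2*m + 2)]) ! i"
      using lend by cases (auto simp: nth_append \<delta>_def)
  qed (use len lend in simp)
  then have ext: "\<gamma> = extend m y (2*k) \<delta>" using ay fin s2 by (simp add: extend_def)
  have "even h" using s1 s2 by presburger
  then obtain k' where h: "h = 2*k'" by (elim evenE)
  have "up_step \<delta> t \<or> down_step \<delta> t" if "t \<in> {1..2*m}" for t
    using steps[of t] that lend unfolding ext extend_def by (auto simp: up_step_append down_step_append)
  moreover have "\<delta> ! 0 = (0, 0)" "\<delta> ! (2*m) = (2*m, 2*k')"
    using start bh s1 h by (auto simp: \<delta>_def)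
  ultimately have "\<delta> \<in> paths m k'" using lend by (simp add: paths_def)
  then show thesis using that ext s1 s2 h by simp
qed

lemma paths_0: "paths 0 k = (if k = 0 then {[(0, 0)]} else {})"
  by (auto simp: paths_def length_Suc_conv)

text \<open>The four sets are the endings up-up, up-down, down-up and down-down. For
  \<open>k = 0\<close> the intermediate height \<open>2*k - 1\<close> would be negative, which
  excludes two of them.\<close>

lemma paths_Suc:
  "paths (Suc m) k = (if k = 0 then {} else extend m (2*k - 1) (2*k) ` paths m (k - 1))
    \<union> extend m (2*k + 1) (2*k) ` paths m k
    \<union> (if k = 0 then {} else extend m (2*k - 1) (2*k) ` paths m k)
    \<union> extend m (2*k + 1) (2*k) ` paths m (Suc k)" (is "_ = ?R")
proof
  show "paths (Suc m) k \<subseteq> ?R"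
  proof
    fix \<gamma> assume "\<gamma> \<in> paths (Suc m) k"
    then obtain \<delta> y k' where \<delta>: "\<delta> \<in> paths m k'" "\<gamma> = extend m y (2*k) \<delta>"
      and y: "y = 2*k' + 1 \<or> y + 1 = 2*k'" "2*k = y + 1 \<or> 2*k + 1 = y"
      by (rule paths_extend_cases)
    consider "k' + 1 = k" "y = 2*k - 1" | "k' = k" "y = 2*k + 1" | "k' = k" "k \<noteq> 0" "y = 2*k - 1"
      | "k' = Suc k" "y = 2*k + 1" using y by force
    then show "\<gamma> \<in> ?R" using \<delta> by cases auto
  qed
  show "?R \<subseteq> paths (Suc m) k"
  proof -
    have "extend m (2*k + 1) (2*k) \<gamma> \<in> paths (Suc m) k" if "\<gamma> \<in> paths m k \<or> \<gamma> \<in> paths m (Suc k)" for \<gamma>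
      using that extend_in_paths[of \<gamma> m _ "2*k + 1" k] by auto
    moreover have "extend m (2*k - 1) (2*k) \<gamma> \<in> paths (Suc m) k"
      if "\<gamma> \<in> paths m (k - 1) \<or> \<gamma> \<in> paths m k" "k \<noteq> 0" for \<gamma>
    proof -
      have "2*k - 1 = 2*(k - 1) + 1" "2*k - 1 + 1 = 2*k" using that(2) by auto
      then show ?thesis using that(1) extend_in_paths[of \<gamma> m _ "2*k - 1" k] by metis
    qed
    ultimately show ?thesis by (simp only: Un_subset_iff image_subset_iff split: if_split) blast
  qed
qed

lemma finite_paths [simp]: "finite (paths m k)"
  by (induction m arbitrary: k) (simp_all add: paths_0 paths_Suc)


section \<open>Weights of the last pair of steps\<close>

lemma sum_weakly_increasing_pairs:
  "(\<Sum>(a, b) | a \<le> b \<and> b \<le> k. p ^ (a + b)) = qbin p (k + 2) 2"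
proof -
  have "{(a, b). a \<le> b \<and> b \<le> k} = (\<lambda>(b, a). (a, b)) ` Sigma {..k} (\<lambda>b. {..b})" by auto
  then have "(\<Sum>(a, b) | a \<le> b \<and> b \<le> k. p ^ (a + b)) = (\<Sum>(b, a)\<in>Sigma {..k} (\<lambda>b. {..b}). p ^ (a + b))"
    by (simp add: sum.reindex inj_on_def case_prod_beta)
  then show ?thesis unfolding qbin_2 by (simp add: sum.Sigma)
qed

lemma sum_weakly_decreasing_pairs:
  "(\<Sum>(a, b) | b \<le> a \<and> a \<le> k. p ^ (a + b)) = qbin p (k + 2) 2"
proof -
  have "(\<Sum>(a, b) | b \<le> a \<and> a \<le> k. p ^ (a + b)) = (\<Sum>(a, b) | a \<le> b \<and> b \<le> k. p ^ (a + b))"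
    by (rule sum.reindex_bij_witness[of _ prod.swap prod.swap]) (auto simp: add.commute)
  then show ?thesis by (simp add: sum_weakly_increasing_pairs)
qed

text \<open>The weakly increasing and the strictly decreasing pairs partition the square
  \<open>{..k} \<times> {..k}\<close>, over which the sum factors.\<close>

lemma sum_all_pairs:
  "(\<Sum>(a, b) | a \<le> b \<and> b \<le> k. p ^ (a + b)) + (\<Sum>(a, b) | b < a \<and> a \<le> k. p ^ (a + b))
    = (qbin p (Suc k) 1)\<^sup>2"
proof -
  have fin: "finite {(a, b). a \<le> b \<and> b \<le> k}" "finite {(a, b). b < a \<and> a \<le> k}"
    by (rule finite_subset[of _ "{..k} \<times> {..k}"], auto)+
  have "(\<Sum>(a, b) | a \<le> b \<and> b \<le> k. p ^ (a + b)) + (\<Sum>(a, b) | b < a \<and> a \<le> k. p ^ (a + b))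
      = (\<Sum>(a, b)\<in>{(a, b). a \<le> b \<and> b \<le> k} \<union> {(a, b). b < a \<and> a \<le> k}. p ^ (a + b))"
    by (rule sum.union_disjoint[symmetric, OF fin]) auto
  also have "{(a, b). a \<le> b \<and> b \<le> k} \<union> {(a, b). b < a \<and> a \<le> k} = {..k} \<times> {..k}" by auto
  also have "(\<Sum>(a, b)\<in>{..k} \<times> {..k}. p ^ (a + b)) = (\<Sum>a\<le>k. p ^ a)\<^sup>2"
    by (simp add: power2_eq_square sum_product sum.cartesian_product power_add)
  finally show ?thesis unfolding One_nat_def qbin_1 .
qed

lemma powi_diff_nat:
  fixes q :: "'a::field"
  assumes "q \<noteq> 0" "e = int c - int d"
  shows "q powi e = q ^ c * inverse q ^ d"
  using assms by (simp add: power_int_diff power_inverse divide_inverse)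

text \<open>\<open>P y z\<close> is the total weight of a last pair through heights \<open>y\<close>
  and \<open>z\<close>, started at height \<open>2*k\<close>. In the down-down case
  \<open>l = k - 1\<close>, which turns the strict bound by \<open>k\<close> into a weak bound by
  \<open>l\<close>.\<close>

lemma label_sums_extend:
  fixes q :: "'a::field"
  assumes q: "q \<noteq> 0" and \<gamma>: "\<gamma> \<in> paths m k"
  defines "P \<equiv> \<lambda>y z. label_sum q (extend m y z \<gamma>) (2 * Suc m - 1) * label_sum q (extend m y z \<gamma>) (2 * Suc m)"
  shows "P (2*k + 1) (2 * Suc k) = 1"
    and "P (2*k + 1) (2*k) = q ^ (2*k) * (\<Sum>(a, b) | a \<le> b \<and> b \<le> k. inverse q ^ (a + b))"
    and "k \<noteq> 0 \<Longrightarrow> P (2*k - 1) (2*k) = q ^ (2*k) * (\<Sum>(a, b) | b < a \<and> a \<le> k. inverse q ^ (a + b))"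
    and "k = Suc l \<Longrightarrow> P (2*l + 1) (2*l) = q ^ (4*l + 1) * (qbin (inverse q) (l + 2) 2)\<^sup>2"
proof -
  note st = steps_extend[OF \<gamma>]
  have j: "1 \<le> Suc m" by simp
  have hh: "half_height (extend m y z \<gamma>) (Suc m) = int k" for y z
    using st(5)[of y z] by (simp add: half_height_def)
  have e: "q powi (2 * int k - int (fst x) - int (snd x)) = q ^ (2*k) * inverse q ^ (fst x + snd x)" for x
    by (rule powi_diff_nat[OF q]) simp
  note lab = label_sum_def st step_labels_first[OF j] step_labels_second[OF j]
    step_exponent_first[OF j] step_exponent_second[OF j] hh
  show "P (2*k + 1) (2 * Suc k) = 1"
    unfolding P_def lab by simp
  show "P (2*k + 1) (2*k) = q ^ (2*k) * (\<Sum>(a, b) | a \<le> b \<and> b \<le> k. inverse q ^ (a + b))"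
    unfolding P_def lab by (simp add: e sum_distrib_left case_prod_beta)
  show "P (2*k - 1) (2*k) = q ^ (2*k) * (\<Sum>(a, b) | b < a \<and> a \<le> k. inverse q ^ (a + b))" if "k \<noteq> 0"
    using that unfolding P_def lab by (simp add: e sum_distrib_left case_prod_beta)
  show "P (2*l + 1) (2*l) = q ^ (4*l + 1) * (qbin (inverse q) (l + 2) 2)\<^sup>2" if k: "k = Suc l"
  proof -
    have e1: "q powi (2 * int k - int (fst x) - int (snd x) - 1) = q ^ (2*l + 1) * inverse q ^ (fst x + snd x)" for x
      by (rule powi_diff_nat[OF q]) (simp add: k)
    have e2: "q powi (2 * int k - int (fst x) - int (snd x) - 2) = q ^ (2*l) * inverse q ^ (fst x + snd x)" for x
      by (rule powi_diff_nat[OF q]) (simp add: k)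
    have c: "(2*l + 1 = 2*k + 1) = False" "(2*l + 1 + 1 = 2*k) = True" "(2*l = 2*l + 1 + 1) = False"
      "2*k div 2 = k" "\<And>a. (a < k) = (a \<le> l)" using k by auto
    have first: "label_sum q (extend m (2*l + 1) (2*l) \<gamma>) (2 * Suc m - 1)
        = q ^ (2*l + 1) * (\<Sum>(a, b) | b \<le> a \<and> a \<le> l. inverse q ^ (a + b))"
      unfolding lab sum_distrib_left by (simp only: c e1 if_True if_False case_prod_beta)
    have second: "label_sum q (extend m (2*l + 1) (2*l) \<gamma>) (2 * Suc m)
        = q ^ (2*l) * (\<Sum>(a, b) | a \<le> b \<and> b \<le> l. inverse q ^ (a + b))"
      unfolding lab sum_distrib_left by (simp only: c e2 simp_thms if_True if_False case_prod_beta)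
    \<comment> \<open>The two exponents are \<open>2*k - 1\<close> and \<open>2*k - 2\<close> with
      \<open>k = Suc l\<close>.\<close>
    have "q ^ (4*l + 1) = q ^ (2*l + 1) * q ^ (2*l)" by (simp add: power_add[symmetric])
    then show ?thesis
      unfolding P_def first second sum_weakly_increasing_pairs sum_weakly_decreasing_pairs
      by (simp only: power2_eq_square mult_ac)
  qed
qed

text \<open>The last pair contributes a factor depending only on its shape and its starting height,
  not on the rest of the path.\<close>

lemma sum_paths_history_sum:
  fixes q :: "'a::field"
  assumes q: "q \<noteq> 0"
  shows "(\<Sum>\<gamma>\<in>paths m k. \<Prod>t\<in>{1..2*m}. label_sum q \<gamma> t) = history_sum q m k"
proof (induction m arbitrary: k)
  case 0
  then show ?case by (simp add: paths_0)
next
  case (Suc m)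
  let ?W = "\<lambda>m \<gamma>. \<Prod>t\<in>{1..2*m}. label_sum q \<gamma> t"
  have ext: "(\<Sum>\<gamma>\<in>extend m y z ` paths m k'. ?W (Suc m) \<gamma>) = w * history_sum q m k'"
    if w: "\<And>\<gamma>. \<gamma> \<in> paths m k' \<Longrightarrow>
      label_sum q (extend m y z \<gamma>) (2 * Suc m - 1) * label_sum q (extend m y z \<gamma>) (2 * Suc m) = w"
    for y z k' w
  proof -
    have "?W (Suc m) (extend m y z \<gamma>) = w * ?W m \<gamma>" if \<gamma>: "\<gamma> \<in> paths m k'" for \<gamma>
    proof -
      have "{1..2 * Suc m} = insert (2 * Suc m) (insert (2 * Suc m - 1) {1..2*m})" by auto
      then have "?W (Suc m) (extend m y z \<gamma>) = w * (\<Prod>t\<in>{1..2*m}. label_sum q (extend m y z \<gamma>) t)"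
        unfolding w[OF \<gamma>, symmetric] by (simp add: mult_ac)
      also have "(\<Prod>t\<in>{1..2*m}. label_sum q (extend m y z \<gamma>) t) = ?W m \<gamma>"
        using \<gamma> label_sum_append[of \<gamma> m] by (intro prod.cong) (simp_all add: extend_def paths_def)
      finally show ?thesis .
    qed
    then show ?thesis
      unfolding sum.reindex[OF inj_extend] comp_def Suc.IH[symmetric] sum_distrib_left
      by (intro sum.cong refl)
  qed
  let ?UU = "if k = 0 then {} else extend m (2*k - 1) (2*k) ` paths m (k - 1)"
  let ?UD = "extend m (2*k + 1) (2*k) ` paths m k"
  let ?DU = "if k = 0 then {} else extend m (2*k - 1) (2*k) ` paths m k"
  let ?DD = "extend m (2*k + 1) (2*k) ` paths m (Suc k)"
  let ?inc = "\<Sum>(a, b) | a \<le> b \<and> b \<le> k. inverse q ^ (a + b)"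
  let ?dec = "\<Sum>(a, b) | b < a \<and> a \<le> k. inverse q ^ (a + b)"
  have UU: "sum (?W (Suc m)) ?UU = (if k = 0 then 0 else history_sum q m (k - 1))"
  proof (cases k)
    case (Suc l)
    then show ?thesis
      using ext[of l "2*l + 1" "2 * Suc l" 1] label_sums_extend(1)[OF q, of _ m l] by simp
  qed simp
  have UD: "sum (?W (Suc m)) ?UD = q ^ (2*k) * ?inc * history_sum q m k"
    using label_sums_extend(2)[OF q] by (intro ext)
  have DU: "sum (?W (Suc m)) ?DU = q ^ (2*k) * ?dec * history_sum q m k"
  proof (cases "k = 0")
    case False
    then show ?thesis using label_sums_extend(3)[OF q] by (simp only: if_False) (intro ext)
  next
    case True
    \<comment> \<open>At height 0 no down-up pair exists; the formula remains valid because there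
      are no labels \<open>b < a \<le> 0\<close> either.\<close>
    have "{(a, b). b < a \<and> a \<le> k} = {}" using True by auto
    then have "?dec = 0" by (simp only: sum.empty)
    then show ?thesis using True by (simp only: simp_thms if_True sum.empty mult_zero_right mult_zero_left)
  qed
  have DD: "sum (?W (Suc m)) ?DD = q ^ (4*k + 1) * (qbin (inverse q) (k + 2) 2)\<^sup>2 * history_sum q m (Suc k)"
    using label_sums_extend(4)[OF q _ refl] by (intro ext)
  \<comment> \<open>Endings are told apart by the intermediate height and the height two steps
    before the end.\<close>
  have "?UU \<inter> ?UD = {}" "(?UU \<union> ?UD) \<inter> ?DU = {}" "(?UU \<union> ?UD \<union> ?DU) \<inter> ?DD = {}"
    by (auto simp: extend_def paths_def)
  then have "sum (?W (Suc m)) (paths (Suc m) k) =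
      sum (?W (Suc m)) ?UU + sum (?W (Suc m)) ?UD + sum (?W (Suc m)) ?DU + sum (?W (Suc m)) ?DD"
    unfolding paths_Suc by (simp add: sum.union_disjoint)
  also have "\<dots> = history_sum q (Suc m) k"
    unfolding UU UD DU DD history_sum.simps sum_all_pairs[symmetric] by (simp add: algebra_simps)
  finally show ?case .
qed

section \<open>Total weights of histories and configurations\<close>

lemma DH_eq_Sigma: "DH n = Sigma (paths n 0) (\<lambda>\<gamma>. {\<xi>. (\<gamma>, \<xi>) \<in> DH n})"
  by (auto simp: DH_def dyck_path_iff_paths)

lemma finite_DH_labels: "\<gamma> \<in> paths n 0 \<Longrightarrow> finite {\<xi>. (\<gamma>, \<xi>) \<in> DH n}"
  using bij_betw_finite[OF bij_betw_DH_labels, of n \<gamma>]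
  by (simp add: dyck_path_iff_paths finite_PiE)

lemma finite_DH: "finite (DH n)"
  by (subst DH_eq_Sigma) (auto intro: finite_SigmaI finite_DH_labels)

lemma prod_power_int:
  fixes q :: "'a::field"
  assumes "q \<noteq> 0" "finite A"
  shows "(\<Prod>i\<in>A. q powi f i) = q powi (\<Sum>i\<in>A. f i)"
  using assms(2) by (induction A rule: finite_induct) (simp_all add: power_int_add assms(1))

text \<open>Collecting the weight into a single integer power of \<open>fls_X\<close> prepares the
  comparison of coefficients.\<close>

lemma weight_eq: "weight n H =
    fls_X powi (\<Sum>i=1..n. step_exponent (fst H) (down_pos (fst H) i) (snd H ! (i - 1)))"
  unfolding weight_def step_weight_eq by (rule prod_power_int) simp_all

lemma sum_DH_weight: "(\<Sum>H\<in>DH n. weight n H) = history_sum fls_X n 0"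
proof -
  have "(\<Sum>H\<in>DH n. weight n H) = (\<Sum>\<gamma>\<in>paths n 0. \<Sum>\<xi> | (\<gamma>, \<xi>) \<in> DH n. weight n (\<gamma>, \<xi>))"
    by (subst DH_eq_Sigma) (simp add: sum.Sigma finite_DH_labels)
  also have "\<dots> = (\<Sum>\<gamma>\<in>paths n 0. \<Prod>t\<in>{1..2*n}. label_sum fls_X \<gamma> t)"
    unfolding weight_def step_weight_eq fst_conv snd_conv
    by (intro sum.cong refl sum_DH_labels) (simp only: dyck_path_iff_paths)
  also have "\<dots> = history_sum fls_X n 0" by (rule sum_paths_history_sum) simp
  finally show ?thesis .
qed

text \<open>This is level \<open>k = 0\<close> of the comparison of recursions, where
  \<open>gauge\<close> is 1 and the normalising power is \<open>q ^ (n choose 2)\<close>.\<close>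

lemma sum_DC_powi:
  "(\<Sum>C\<in>DC n. fls_X powi (int (n choose 2) - int (inv_DC C)) :: rat fls) = history_sum fls_X n 0"
proof -
  have q: "(fls_X :: rat fls) \<noteq> 0" by simp
  have "(\<Sum>C\<in>DC n. fls_X powi (int (n choose 2) - int (inv_DC C)) :: rat fls)
      = fls_X ^ (n choose 2) * (\<Sum>C\<in>DC n. inverse fls_X ^ inv_DC C)"
    unfolding sum_distrib_left by (intro sum.cong refl powi_diff_nat[OF q])
  then show ?thesis
    using content_sum_eq_history_sum[OF q, of n 0] by (simp add: sum_DC_content_sum)
qed

theorem theorem6:
  fixes n :: nat
  assumes "n \<ge> 1"
  shows "\<exists>\<Phi>. bij_betw \<Phi> (DC n) (DH n) \<and>
           (\<forall>C\<in>DC n. weight n (\<Phi> C) = q_var powi (int (n choose 2) - int (inv_DC C)))"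
proof -
  let ?f = "\<lambda>C. int (n choose 2) - int (inv_DC C)"
  let ?g = "\<lambda>H. \<Sum>i=1..n. step_exponent (fst H) (down_pos (fst H) i) (snd H ! (i - 1))"
  \<comment> \<open>Both sums equal \<open>history_sum fls_X n 0\<close>, so every exponent is
    attained equally often on the two sides.\<close>
  have "(\<Sum>C\<in>DC n. q_var powi ?f C) = (\<Sum>H\<in>DH n. q_var powi ?g H)"
    unfolding sum_DC_powi weight_eq[symmetric] sum_DH_weight ..
  from bij_betw_of_sum_powi_eq[OF finite_DC finite_DH this]
  obtain \<Phi> where \<Phi>: "bij_betw \<Phi> (DC n) (DH n)" and eq: "\<And>C. C \<in> DC n \<Longrightarrow> ?g (\<Phi> C) = ?f C" by blast
  have "weight n (\<Phi> C) = q_var powi ?f C" if "C \<in> DC n" for C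
    unfolding weight_eq using eq[OF that] by (rule arg_cong)
  then show ?thesis using \<Phi> by blast
qed

end
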